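(* Let $0<\delta<0.5$ be a constant and let $\mathcal{G}(n,\delta)$ denote the class of graphs on vertex set $[n]$ with minimum degree at least $\delta n$. Then: (i) For every $H\in\mathcal{G}(n,\delta)$, if $r=3$ and $m\geq 60\delta^{-2}\log n$, then with high probability $G^r_{H,m}$ is rainbow connected. (ii) For $\delta\leq 0.1$ there exists $H\in\mathcal{G}(n,\delta)$ such that if $m\leq 0.5\log n$ then with high probability $G^4_{H,m}$ is not rainbow connected. (iii) For every $H\in\mathcal{G}(n,\delta)$, if $r=7$ and $m=\omega(1)$, then with high probability $G^r_{H,m}$ is rainbow connected.
   Context: Given a graph $H=(V,E)$ on $V=[n]$, let $R$ be a set of $m$ edges chosen uniformly at random from $\binom{[n]}{2}\setminus E$, and let $G_{H,m}=(V,E\cup R)$. The graph $G^r_{H,m}$ is obtained by coloring every edge of $G_{H,m}$ independently and uniformly at random with a color from $[r]$. A path is rainbow if no color appears twice on its edges; an edge-colored graph is rainbow connected if every pair of its vertices is joined by a rainbow path. "With high probability" means with probability tending to $1$ as $n\to\infty$. *)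

theory Defs
  imports "HOL-Probability.Probability" "HOL-Library.Ramsey"
begin

text \<open>A graph with vertex set \<open>{1..n}\<close> is given by its edge set, a set of two-element
  subsets of \<open>{1..n}\<close>.\<close>

definition degree :: "nat set set \<Rightarrow> nat \<Rightarrow> nat" where
  "degree E v = card {e \<in> E. v \<in> e}"

definition min_degree :: "nat \<Rightarrow> nat set set \<Rightarrow> nat" where
  "min_degree n E = Min (degree E ` {1..n})"

definition dense_graphs :: "nat \<Rightarrow> real \<Rightarrow> nat set set set" where
  "dense_graphs n \<delta> = {E. E \<subseteq> nsets {1..n} 2 \<and> \<delta> * real n \<le> real (min_degree n E)}"

definition non_edges :: "nat \<Rightarrow> nat set set \<Rightarrow> nat set set" where
  "non_edges n E = nsets {1..n} 2 - E"

fun path_edges :: "nat list \<Rightarrow> nat set list" where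
  "path_edges (x # y # xs) = {x, y} # path_edges (y # xs)"
| "path_edges xs = []"

text \<open>A path is the non-empty list of its pairwise distinct vertices, in order.\<close>

definition is_path :: "nat \<Rightarrow> nat set set \<Rightarrow> nat \<Rightarrow> nat list \<Rightarrow> nat \<Rightarrow> bool" where
  "is_path n E u p v \<longleftrightarrow>
     p \<noteq> [] \<and> hd p = u \<and> last p = v \<and> distinct p \<and> set p \<subseteq> {1..n} \<and> set (path_edges p) \<subseteq> E"

definition rainbow :: "(nat set \<Rightarrow> nat) \<Rightarrow> nat list \<Rightarrow> bool" where
  "rainbow c p \<longleftrightarrow> distinct (map c (path_edges p))"

definition rainbow_connected :: "nat \<Rightarrow> nat set set \<times> (nat set \<Rightarrow> nat) \<Rightarrow> bool" where
  "rainbow_connected n = (\<lambda>(E, c).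
     \<forall>u \<in> {1..n}. \<forall>v \<in> {1..n}. \<exists>p. is_path n E u p v \<and> rainbow c p)"

text \<open>The random edge-coloured graph \<open>G\<^sup>r\<^bsub>H,m\<^esub>\<close>, where \<open>E\<close> is the edge set of \<open>H\<close>. It is
  meaningful only for \<open>m \<le> card (non_edges n E)\<close>, since \<open>pmf_of_set\<close> is unspecified on the
  empty set. Colours are \<open>1, \<dots>, r\<close>; non-edges get the dummy value \<open>0\<close>.\<close>

definition random_coloured_graph ::
  "nat \<Rightarrow> nat set set \<Rightarrow> nat \<Rightarrow> nat \<Rightarrow> (nat set set \<times> (nat set \<Rightarrow> nat)) pmf" where
  "random_coloured_graph n E m r =
     bind_pmf (pmf_of_set (nsets (non_edges n E) m)) (\<lambda>R.
       map_pmf (\<lambda>c. (E \<union> R, c)) (Pi_pmf (E \<union> R) 0 (\<lambda>_. pmf_of_set {1..r})))"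

definition whp :: "(nat \<Rightarrow> 'a pmf) \<Rightarrow> (nat \<Rightarrow> 'a \<Rightarrow> bool) \<Rightarrow> bool" where
  "whp M P \<longleftrightarrow> (\<lambda>n. measure_pmf.prob (M n) {x. P n x}) \<longlonglongrightarrow> 1"

end

theory Submission
  imports Defs "HOL-Real_Asymp.Real_Asymp"
begin

text \<open>Colour all pairs of vertices in advance; the random edge set \<open>R\<close> and the colouring are then
  independent. If \<open>u\<close> and \<open>v\<close> have linearly many common neighbours, some path \<open>u w v\<close> carries two
  prescribed colours outside an exponentially small event. Otherwise their private neighbourhoods
  \<open>A\<close> and \<open>B\<close> are disjoint and linear, and for all but an exponentially small part of the
  colourings a constant proportion of the pairs \<open>ab\<close> would turn \<open>u a b v\<close> into a path coloured
  \<open>1, 2, 3\<close>. Unless \<open>H\<close> contains such a pair as an edge, \<open>R\<close> avoids all of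
  them with probability exponentially small in \<open>m\<close>. A union bound over \<open>u, v\<close> gives (i).

  For (iii) take a maximal set \<open>X\<close> of vertices with almost disjoint neighbourhoods; its size is at
  most \<open>2 / \<delta>\<close>, and every other vertex shares linearly many neighbours with a member of \<open>X\<close>. One
  enters \<open>X\<close> with colours \<open>4, 5\<close>, moves inside \<open>X\<close> with colours \<open>1, 2, 3\<close> and leaves it with
  colours \<open>6, 7\<close>; only boundedly many pairs inside \<open>X\<close> depend on \<open>R\<close>.

  For (ii) let \<open>H\<close> be two disjoint complete bipartite graphs \<open>P\<^sub>1, Q\<^sub>1\<close> and \<open>P\<^sub>2, Q\<^sub>2\<close>. When \<open>R\<close> is a
  matching, a path with at most four edges between untouched vertices \<open>u\<close> of \<open>Q\<^sub>1\<close> and \<open>v\<close> of \<open>Q\<^sub>2\<close>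
  uses an edge of \<open>R\<close> right after its first or right before its last edge. Given \<open>R\<close> and
  its colours, the untouched vertices of \<open>Q\<^sub>1\<close> independently have, with probability at least
  \<open>4\<^sup>-\<^sup>m\<close> (much more than \<open>1 / n\<close>), a colour clash with every crossing edge of \<open>R\<close> at \<open>P\<^sub>1\<close>, so one
  of them is blocked in this sense; likewise in \<open>Q\<^sub>2\<close>. Two such vertices have no short rainbow path.\<close>

subsection \<open>Rainbow walks\<close>

text \<open>Walks instead of paths: joining them needs no check that vertices are distinct. The set
  \<open>C\<close> bounds the colours used, so that pieces with disjoint colour sets can be
  joined.\<close>

definition reach :: "nat set set \<Rightarrow> (nat set \<Rightarrow> nat) \<Rightarrow> nat set \<Rightarrow> nat \<Rightarrow> nat \<Rightarrow> bool" where
  "reach E c C u v \<longleftrightarrow>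
     (\<exists>p. p \<noteq> [] \<and> hd p = u \<and> last p = v \<and> set (path_edges p) \<subseteq> E \<and> rainbow c p \<and>
        c ` set (path_edges p) \<subseteq> C)"

lemma path_edges_append:
  "path_edges (xs @ y # ys) = path_edges (xs @ [y]) @ path_edges (y # ys)"
proof (induction xs)
  case (Cons x xs)
  then show ?case by (cases xs) auto
qed simp

lemma length_path_edges: "length (path_edges p) = length p - 1"
  by (induction p rule: path_edges.induct) auto

text \<open>Cutting out the closed part between two visits to a vertex only deletes edges, so the
  shorter walk is still rainbow; induction on the length ends at a path.\<close>

lemma rainbow_walk_imp_path:
  assumes "p \<noteq> []" "hd p = u" "last p = v" "set (path_edges p) \<subseteq> E" "rainbow c p"
    and E: "E \<subseteq> nsets {1..n} 2" and u: "u \<in> {1..n}"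
  shows "\<exists>p. is_path n E u p v \<and> rainbow c p"
  using assms(1-5)
proof (induction "length p" arbitrary: p rule: less_induct)
  case less
  show ?case
  proof (cases "distinct p")
    case True
    have "set (path_edges p) \<subseteq> nsets {1..n} 2" if "set (path_edges p) \<subseteq> E" for p using that E by blast
    moreover have "hd p \<in> {1..n} \<Longrightarrow> set (path_edges p) \<subseteq> nsets {1..n} 2 \<Longrightarrow> set p \<subseteq> {1..n}"
      by (induction p rule: path_edges.induct) auto
    ultimately have "set p \<subseteq> {1..n}" using less.prems u by blast
    then show ?thesis using True less.prems unfolding is_path_def by blast
  next
    case False
    then obtain xs ys zs y where p: "p = xs @ [y] @ ys @ [y] @ zs"
      using not_distinct_decomp by blast
    have e: "path_edges p = path_edges (xs @ [y]) @ path_edges ((y # ys) @ [y]) @ path_edges (y # zs)"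
      using path_edges_append[of xs y "ys @ y # zs"] path_edges_append[of "y # ys" y zs] p by simp
    let ?q = "xs @ y # zs"
    have q: "path_edges ?q = path_edges (xs @ [y]) @ path_edges (y # zs)"
      by (rule path_edges_append)
    show ?thesis
    proof (rule less.hyps)
      show "length ?q < length p" "?q \<noteq> []" using p by auto
      show "hd ?q = u" using less.prems p by (cases xs) auto
      show "last ?q = v" using less.prems p by auto
      show "set (path_edges ?q) \<subseteq> E" "rainbow c ?q"
        using less.prems e q unfolding rainbow_def by auto
    qed
  qed
qed

lemma reach_imp_path:
  assumes "reach E c C u v" "E \<subseteq> nsets {1..n} 2" "u \<in> {1..n}"
  shows "\<exists>p. is_path n E u p v \<and> rainbow c p"
  using assms rainbow_walk_imp_path unfolding reach_def by metis

lemma reach_refl: "reach E c C u u"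
  unfolding reach_def by (rule exI[of _ "[u]"]) (simp add: rainbow_def)

lemma reach_edge: "{u, v} \<in> E \<Longrightarrow> c {u, v} \<in> C \<Longrightarrow> reach E c C u v"
  unfolding reach_def by (rule exI[of _ "[u, v]"]) (simp add: rainbow_def)

text \<open>Each piece is rainbow and no colour occurs in both, so the concatenation is
  rainbow.\<close>

lemma reach_trans:
  assumes "reach E c C u v" "reach E c D v w" "C \<inter> D = {}"
  shows "reach E c (C \<union> D) u w"
proof -
  obtain p where p: "p \<noteq> []" "hd p = u" "last p = v" "set (path_edges p) \<subseteq> E" "rainbow c p"
    "c ` set (path_edges p) \<subseteq> C" using assms(1) unfolding reach_def by blast
  obtain q where q: "q \<noteq> []" "hd q = v" "last q = w" "set (path_edges q) \<subseteq> E" "rainbow c q"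
    "c ` set (path_edges q) \<subseteq> D" using assms(2) unfolding reach_def by blast
  have pb: "p = butlast p @ [v]" using p by (metis append_butlast_last_id)
  have qt: "q = v # tl q" using q by (metis list.collapse)
  \<comment> \<open>The vertex \<open>v\<close> ends \<open>p\<close> and starts \<open>q\<close>;
    it is kept once, so that the edge lists are simply appended.\<close>
  let ?s = "butlast p @ q"
  have e: "path_edges ?s = path_edges p @ path_edges q"
    using path_edges_append[of "butlast p" v "tl q"] pb qt by simp
  have "hd ?s = u" using p(2) q(2) pb by (metis append_Nil hd_append list.sel(1))
  moreover have "c ` set (path_edges p) \<inter> c ` set (path_edges q) = {}"
    using p(6) q(6) assms(3) by blast
  then have "rainbow c ?s"
    using p(5) q(5) unfolding rainbow_def e by simp
  ultimately show ?thesis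
    unfolding reach_def by (intro exI[of _ ?s]) (use p q e in auto)
qed

subsection \<open>Random colourings of all pairs\<close>

text \<open>With \<open>W\<close> the set of all pairs, the colouring does not refer to the random
  edges; only its values on the edges present will matter.\<close>

definition colouring :: "nat set set \<Rightarrow> nat \<Rightarrow> (nat set \<Rightarrow> nat) pmf" where
  "colouring W r = Pi_pmf W 0 (\<lambda>_. pmf_of_set {1..r})"

lemma prob_pattern:
  assumes "finite W" "K \<subseteq> W" "\<And>x. x \<in> K \<Longrightarrow> f x \<in> {1..r}"
  shows "measure_pmf.prob (colouring W r) {c. \<forall>x\<in>K. c x = f x} = (1 / real r) ^ card K"
proof -
  have eq: "{c. \<forall>x\<in>K. c x = f x} = Pi W (\<lambda>x. if x \<in> K then {f x} else UNIV)"
    using assms(2) by (auto simp: Pi_def)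
  have "measure_pmf.prob (colouring W r) {c. \<forall>x\<in>K. c x = f x} =
      (\<Prod>x\<in>W. measure_pmf.prob (pmf_of_set {1..r}) (if x \<in> K then {f x} else UNIV))"
    unfolding eq colouring_def by (rule measure_Pi_pmf_Pi[OF assms(1)])
  also have "\<dots> = (\<Prod>x\<in>W. if x \<in> K then 1 / real r else 1)"
  proof (rule prod.cong[OF refl])
    fix x assume "x \<in> W"
    show "measure_pmf.prob (pmf_of_set {1..r}) (if x \<in> K then {f x} else UNIV) =
        (if x \<in> K then 1 / real r else 1)"
      using assms(3)[of x] by (auto simp: measure_pmf_single)
  qed
  also have "\<dots> = (\<Prod>x\<in>K. 1 / real r)"
    using assms(1,2) by (simp add: prod.inter_restrict[symmetric] Int_absorb1)
  finally show ?thesis by simp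
qed

text \<open>The \<open>i\<close>-th indicator depends only on the coordinates in \<open>K i\<close>,
  and disjoint blocks of independent coordinates are independent.\<close>

lemma indep_pattern:
  fixes f :: "'i \<Rightarrow> nat set \<Rightarrow> nat"
  assumes "finite W" "\<And>i. i \<in> I \<Longrightarrow> K i \<subseteq> W" "disjoint_family_on K I"
  shows "prob_space.indep_vars (measure_pmf (colouring W r)) (\<lambda>_. borel)
    (\<lambda>i c. if \<forall>x\<in>K i. c x = f i x then 1 else 0 :: real) I"
proof -
  have "prob_space.indep_vars (measure_pmf (colouring W r)) (\<lambda>_. count_space UNIV) (\<lambda>x c. c x) W"
    unfolding colouring_def by (rule indep_vars_Pi_pmf[OF assms(1)])
  from prob_space.indep_vars_restrict[OF prob_space_measure_pmf this assms(2,3)]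
  have 1: "prob_space.indep_vars (measure_pmf (colouring W r)) (\<lambda>j. PiM (K j) (\<lambda>_. count_space UNIV)) (\<lambda>j c. restrict (\<lambda>i. c i) (K j)) I" by simp
  have "prob_space.indep_vars (measure_pmf (colouring W r)) (\<lambda>_. borel)
    (\<lambda>i c. (\<lambda>g. if \<forall>x\<in>K i. g x = f i x then 1 else 0 :: real) (restrict (\<lambda>i. c i) (K i))) I"
  proof (rule prob_space.indep_vars_compose2[OF prob_space_measure_pmf 1])
    fix i assume "i \<in> I"
    then have "countable (K i)" using assms by (meson countable_finite finite_subset)
    then show "(\<lambda>g. if \<forall>x\<in>K i. g x = f i x then 1 else 0 :: real)
        \<in> borel_measurable (PiM (K i) (\<lambda>_. count_space UNIV))"
      by measurable
  qed
  then show ?thesis by (simp cong: if_cong)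
qed

lemma expectation_pattern:
  assumes "finite W" "K \<subseteq> W" "\<And>x. x \<in> K \<Longrightarrow> f x \<in> {1..r}"
  shows "measure_pmf.expectation (colouring W r) (\<lambda>c. if \<forall>x\<in>K. c x = f x then 1 else 0 :: real)
    = (1 / real r) ^ card K"
proof -
  have "(\<lambda>c. if \<forall>x\<in>K. c x = f x then 1 else 0 :: real) = indicator {c. \<forall>x\<in>K. c x = f x}"
    by (auto simp: indicator_def)
  then show ?thesis using prob_pattern[OF assms] by simp
qed

text \<open>Independence gives the product of the factors \<open>1 - (1 / r) ^ card (K i)\<close>,
  each at most \<open>exp (- (1 / r ^ d))\<close>. Smaller patterns are only more likely, so an
  upper bound \<open>d\<close> on the sizes is enough.\<close>

lemma prob_no_pattern:
  fixes f :: "'i \<Rightarrow> nat set \<Rightarrow> nat"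
  assumes W: "finite W" and I: "finite I" and K: "\<And>i. i \<in> I \<Longrightarrow> K i \<subseteq> W" "disjoint_family_on K I"
    and f: "\<And>i x. i \<in> I \<Longrightarrow> x \<in> K i \<Longrightarrow> f i x \<in> {1..r}"
    and d: "\<And>i. i \<in> I \<Longrightarrow> card (K i) \<le> d" and r: "r \<ge> 1"
  shows "measure_pmf.prob (colouring W r) {c. \<forall>i\<in>I. \<not> (\<forall>x\<in>K i. c x = f i x)}
    \<le> exp (- (real (card I) / real r ^ d))"
proof -
  let ?X = "\<lambda>i c. if \<forall>x\<in>K i. c x = f i x then 1 else 0 :: real"
  have ind: "prob_space.indep_vars (measure_pmf (colouring W r)) (\<lambda>_. borel) ?X I" by (rule indep_pattern[OF W K])
  have ind': "prob_space.indep_vars (measure_pmf (colouring W r)) (\<lambda>_. borel) (\<lambda>i c. 1 - ?X i c) I"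
    by (rule prob_space.indep_vars_compose2[OF prob_space_measure_pmf ind]) measurable
  have int: "integrable (measure_pmf (colouring W r)) (\<lambda>c. 1 - ?X i c)" for i
    by (rule measure_pmf.integrable_const_bound[where B=1]) auto
  have int': "integrable (measure_pmf (colouring W r)) (?X i)" for i
    by (rule measure_pmf.integrable_const_bound[where B=1]) auto
  have "indicator {c. \<forall>i\<in>I. \<not> (\<forall>x\<in>K i. c x = f i x)} c = (\<Prod>i\<in>I. 1 - ?X i c)" for c :: "nat set \<Rightarrow> nat"
  proof (cases "\<exists>i\<in>I. \<forall>x\<in>K i. c x = f i x")
    case True
    then have "(\<Prod>i\<in>I. 1 - ?X i c) = 0" using I by (intro prod_zero) auto
    then show ?thesis using True by (auto simp: indicator_def)
  next
    case False
    then have "(\<Prod>i\<in>I. 1 - ?X i c) = 1" by (intro prod.neutral) auto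
    then show ?thesis using False by (auto simp: indicator_def)
  qed
  then have eq: "indicator {c. \<forall>i\<in>I. \<not> (\<forall>x\<in>K i. c x = f i x)} = (\<lambda>c. \<Prod>i\<in>I. 1 - ?X i c)"
    by (rule ext)
  have "measure_pmf.prob (colouring W r) {c. \<forall>i\<in>I. \<not> (\<forall>x\<in>K i. c x = f i x)} =
      measure_pmf.expectation (colouring W r) (indicator {c. \<forall>i\<in>I. \<not> (\<forall>x\<in>K i. c x = f i x)})"
    by simp
  also have "\<dots> = measure_pmf.expectation (colouring W r) (\<lambda>c. \<Prod>i\<in>I. 1 - ?X i c)"
    by (simp only: eq)
  also have "\<dots> = (\<Prod>i\<in>I. measure_pmf.expectation (colouring W r) (\<lambda>c. 1 - ?X i c))"
    by (rule prob_space.indep_vars_lebesgue_integral[OF prob_space_measure_pmf I ind' int])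
  also have "\<dots> = (\<Prod>i\<in>I. 1 - (1 / real r) ^ card (K i))"
  proof (rule prod.cong[OF refl])
    fix i assume i: "i \<in> I"
    have "measure_pmf.expectation (colouring W r) (\<lambda>c. 1 - ?X i c) = 1 - measure_pmf.expectation (colouring W r) (?X i)"
      using int' by (subst Bochner_Integration.integral_diff) (auto simp: measure_pmf.prob_space)
    then show "measure_pmf.expectation (colouring W r) (\<lambda>c. 1 - ?X i c) = 1 - (1 / real r) ^ card (K i)"
      using expectation_pattern[OF W K(1)[OF i], of "f i" r] f[OF i] by simp
  qed
  also have "\<dots> \<le> (\<Prod>i\<in>I. exp (- (1 / real r ^ d)))"
  proof (rule prod_mono, intro conjI)
    fix i assume i: "i \<in> I"
    show "0 \<le> 1 - (1 / real r) ^ card (K i)" using r by (simp add: power_le_one)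
    have "(1 / real r) ^ d \<le> (1 / real r) ^ card (K i)"
      using r d[OF i] by (intro power_decreasing) auto
    then have "1 - (1 / real r) ^ card (K i) \<le> 1 - 1 / real r ^ d" by (simp add: power_one_over)
    also have "\<dots> \<le> exp (- (1 / real r ^ d))" using exp_ge_add_one_self[of "- (1 / real r ^ d)"] by simp
    finally show "1 - (1 / real r) ^ card (K i) \<le> exp (- (1 / real r ^ d))" .
  qed
  also have "\<dots> = exp (- (real (card I) / real r ^ d))"
    by (simp add: exp_of_nat_mult[symmetric])
  finally show ?thesis .
qed

text \<open>Hoeffding's inequality for a shortfall of one tenth of the mean
  \<open>card I / r ^ d\<close>: twice the squared deviation divided by \<open>card I\<close> is the
  exponent.\<close>

lemma prob_few_pattern:
  fixes f :: "'i \<Rightarrow> nat set \<Rightarrow> nat"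
  assumes W: "finite W" and I: "finite I" and K: "\<And>i. i \<in> I \<Longrightarrow> K i \<subseteq> W" "disjoint_family_on K I"
    and f: "\<And>i x. i \<in> I \<Longrightarrow> x \<in> K i \<Longrightarrow> f i x \<in> {1..r}"
    and d: "\<And>i. i \<in> I \<Longrightarrow> card (K i) = d" and r: "r \<ge> 1"
  shows "measure_pmf.prob (colouring W r)
      {c. real (card {i \<in> I. \<forall>x\<in>K i. c x = f i x}) \<le> 9 / 10 * real (card I) / real r ^ d}
    \<le> exp (- (real (card I) / (50 * real r ^ (2 * d))))"
\<comment> \<open>For empty \<open>I\<close> the bound is \<open>exp 0 = 1\<close>; otherwise the
  sum of squared ranges is positive, as Hoeffding's inequality requires.\<close>
proof (cases "I = {}")
  case True
  then show ?thesis by simp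
next
  case False
  let ?X = "\<lambda>i c. if \<forall>x\<in>K i. c x = f i x then 1 else 0 :: real"
  let ?N = "real (card I)"
  interpret H: Hoeffding_ineq "measure_pmf (colouring W r)" I ?X "\<lambda>_. 0" "\<lambda>_. 1"
    "\<Sum>i\<in>I. measure_pmf.expectation (colouring W r) (?X i)"
  proof unfold_locales
    show "prob_space.indep_vars (measure_pmf (colouring W r)) (\<lambda>_. borel) ?X I" by (rule indep_pattern[OF W K])
  qed (use I in auto)
  have N: "?N > 0" using False I by (simp add: card_gt_0_iff)
  have mu: "(\<Sum>i\<in>I. measure_pmf.expectation (colouring W r) (?X i)) = ?N / real r ^ d"
  proof -
    have "(\<Sum>i\<in>I. measure_pmf.expectation (colouring W r) (?X i)) = (\<Sum>i\<in>I. (1 / real r) ^ d)"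
      using expectation_pattern[OF W K(1)] f d by (intro sum.cong) auto
    then show ?thesis by (simp add: power_one_over)
  qed
  define \<epsilon> where "\<epsilon> = ?N / (10 * real r ^ d)"
  have s: "(\<Sum>i\<in>I. ?X i c) = real (card {i \<in> I. \<forall>x\<in>K i. c x = f i x})" for c
    using I by (simp add: sum.If_cases Int_def)
  have "measure_pmf.prob (colouring W r) {c\<in>space (measure_pmf (colouring W r)). (\<Sum>i\<in>I. ?X i c) \<le> (\<Sum>i\<in>I. measure_pmf.expectation (colouring W r) (?X i)) - \<epsilon>}
      \<le> exp (- 2 * \<epsilon>\<^sup>2 / (\<Sum>i\<in>I. (1 - 0)\<^sup>2))"
    by (rule H.Hoeffding_ineq_le) (use N in \<open>auto simp: \<epsilon>_def\<close>)
  moreover have "(\<Sum>i\<in>I. measure_pmf.expectation (colouring W r) (?X i)) - \<epsilon> = 9 / 10 * ?N / real r ^ d"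
    unfolding mu \<epsilon>_def using r by (simp add: field_simps)
  moreover have "2 * \<epsilon>\<^sup>2 / (\<Sum>i\<in>I. (1 - 0)\<^sup>2) = ?N / (50 * real r ^ (2 * d))"
    unfolding \<epsilon>_def using N r by (simp add: field_simps power2_eq_square power_mult mult_2 power_add)
  ultimately show ?thesis using s by simp
qed

text \<open>Candidates for the middle edge of a walk \<open>u a b v\<close>. They need not be edges
  of the graph, so the set is determined by the colouring alone and can be fixed before
  \<open>R\<close> is drawn.\<close>

definition mid_edges :: "(nat set \<Rightarrow> nat) \<Rightarrow> nat \<Rightarrow> nat set \<Rightarrow> nat set \<Rightarrow> nat \<Rightarrow> nat set set" where
  "mid_edges c u A B v =
     {{a, b} | a b. a \<in> A \<and> b \<in> B \<and> c {u, a} = 1 \<and> c {a, b} = 2 \<and> c {b, v} = 3}"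

text \<open>As \<open>A\<close> and \<open>B\<close> are disjoint, \<open>{a, b}\<close> determines
  which end is which, so ordered pairs can be counted instead.\<close>

lemma card_mid_edges_ge:
  assumes fin: "finite A" "finite B" and dis: "A \<inter> B = {}"
    and a: "x \<le> real (card {a \<in> A. c {u, a} = 1})"
    and b: "\<And>a. a \<in> A \<Longrightarrow> y \<le> real (card {b \<in> B. c {a, b} = 2 \<and> c {b, v} = 3})"
    and "0 \<le> x" "0 \<le> y"
  shows "x * y \<le> real (card (mid_edges c u A B v))"
proof -
  let ?A = "{a \<in> A. c {u, a} = 1}"
  let ?B = "\<lambda>a. {b \<in> B. c {a, b} = 2 \<and> c {b, v} = 3}"
  have inj: "inj_on (\<lambda>(a, b). {a, b}) (Sigma ?A ?B)"
    using dis by (auto simp: inj_on_def doubleton_eq_iff)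
  have "x * y \<le> real (card ?A) * y" using a \<open>0 \<le> y\<close> by (rule mult_right_mono)
  also have "\<dots> = (\<Sum>a\<in>?A. y)" by simp
  also have "\<dots> \<le> (\<Sum>a\<in>?A. real (card (?B a)))" by (rule sum_mono) (use b in auto)
  also have "\<dots> = real (card (Sigma ?A ?B))" using fin by (subst card_SigmaI) auto
  also have "\<dots> = real (card ((\<lambda>(a, b). {a, b}) ` Sigma ?A ?B))" by (subst card_image[OF inj]) simp
  also have "(\<lambda>(a, b). {a, b}) ` Sigma ?A ?B = mid_edges c u A B v"
    unfolding mid_edges_def by force
  finally show ?thesis .
qed

text \<open>Two rounds of concentration: colour 1 on the star from \<open>u\<close> to
  \<open>A\<close>, then, for each fixed \<open>a\<close>, the patterns \<open>{a, b}\<close>,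
  \<open>{b, v}\<close>, which are disjoint for distinct \<open>b\<close>. All \<open>a\<close>
  share the pairs \<open>{b, v}\<close>, so the second round is a union bound, whence the factor
  \<open>card A\<close>.\<close>

lemma prob_few_mid_edges:
  assumes W: "finite W" and fin: "finite A" "finite B" and dis: "A \<inter> B = {}" "v \<notin> A"
    and Wu: "\<And>a. a \<in> A \<Longrightarrow> {u, a} \<in> W" and Wv: "\<And>b. b \<in> B \<Longrightarrow> {b, v} \<in> W"
    and Wab: "\<And>a b. a \<in> A \<Longrightarrow> b \<in> B \<Longrightarrow> {a, b} \<in> W"
    and uv: "u \<notin> A" "v \<notin> B" and r: "r \<ge> 3"
  shows "measure_pmf.prob (colouring W r)
      {c. real (card (mid_edges c u A B v)) < 81 / 100 * real (card A) * real (card B) / real r ^ 3}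
    \<le> exp (- (real (card A) / (50 * real r ^ 2))) + real (card A) * exp (- (real (card B) / (50 * real r ^ 4)))"
proof -
  let ?p = "measure_pmf.prob (colouring W r)"
  define B0 where "B0 = {c :: nat set \<Rightarrow> nat. real (card {a \<in> A. \<forall>x\<in>{{u, a}}. c x = 1}) \<le> 9 / 10 * real (card A) / real r ^ 1}"
  \<comment> \<open>Of the two pairs only \<open>{b, v}\<close> contains \<open>v\<close>, so
    \<open>v \<in> x\<close> tells which colour is prescribed.\<close>
  define B1 where "B1 a = {c :: nat set \<Rightarrow> nat. real (card {b \<in> B. \<forall>x\<in>{{a, b}, {b, v}}. c x = (if v \<in> x then 3 else 2)})
      \<le> 9 / 10 * real (card B) / real r ^ 2}" for a
  have p0: "?p B0 \<le> exp (- (real (card A) / (50 * real r ^ (2 * 1))))"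
    unfolding B0_def
  proof (rule prob_few_pattern[OF W fin(1)])
    show "disjoint_family_on (\<lambda>a. {{u, a}}) A"
      using uv by (auto simp: disjoint_family_on_def doubleton_eq_iff)
  qed (use Wu r in auto)
  have p1: "?p (B1 a) \<le> exp (- (real (card B) / (50 * real r ^ (2 * 2))))" if a: "a \<in> A" for a
    unfolding B1_def
  proof (rule prob_few_pattern[OF W fin(2)])
    show "disjoint_family_on (\<lambda>b. {{a, b}, {b, v}}) B"
      using uv dis a by (auto simp: disjoint_family_on_def doubleton_eq_iff)
    show "card {{a, b}, {b, v}} = 2" if "b \<in> B" for b
    proof -
      have "{a, b} \<noteq> {b, v}" using dis a uv that by (auto simp: doubleton_eq_iff)
      then show ?thesis by simp
    qed
  qed (use Wv Wab r a in \<open>auto split: if_splits\<close>)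
  have sub: "{c. real (card (mid_edges c u A B v)) < 81 / 100 * real (card A) * real (card B) / real r ^ 3}
     \<subseteq> B0 \<union> (\<Union>a\<in>A. B1 a)"
  proof (rule subsetI, rule ccontr)
    fix c assume c: "c \<in> {c. real (card (mid_edges c u A B v)) < 81 / 100 * real (card A) * real (card B) / real r ^ 3}"
      and n: "c \<notin> B0 \<union> (\<Union>a\<in>A. B1 a)"
    have "9 / 10 * real (card A) / real r ^ 1 * (9 / 10 * real (card B) / real r ^ 2)
        \<le> real (card (mid_edges c u A B v))"
    proof (rule card_mid_edges_ge[OF fin dis(1)])
      show "9 / 10 * real (card A) / real r ^ 1 \<le> real (card {a \<in> A. c {u, a} = 1})"
        using n unfolding B0_def by simp
      fix a assume a: "a \<in> A"
      have "{b \<in> B. \<forall>x\<in>{{a, b}, {b, v}}. c x = (if v \<in> x then 3 else 2)} =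
          {b \<in> B. c {a, b} = 2 \<and> c {b, v} = 3}"
        using a dis uv by auto
      then show "9 / 10 * real (card B) / real r ^ 2 \<le> real (card {b \<in> B. c {a, b} = 2 \<and> c {b, v} = 3})"
        using n a unfolding B1_def by fastforce
    qed auto
    then show False using c by (simp add: power_numeral_reduce field_simps)
  qed
  have "?p {c. real (card (mid_edges c u A B v)) < 81 / 100 * real (card A) * real (card B) / real r ^ 3}
      \<le> ?p (B0 \<union> (\<Union>a\<in>A. B1 a))"
    by (rule measure_pmf.finite_measure_mono[OF sub]) simp
  also have "\<dots> \<le> ?p B0 + ?p (\<Union>a\<in>A. B1 a)" by (rule measure_Un_le) auto
  also have "?p (\<Union>a\<in>A. B1 a) \<le> (\<Sum>a\<in>A. ?p (B1 a))" by (rule measure_UNION_le[OF fin(1)]) auto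
  also have "(\<Sum>a\<in>A. ?p (B1 a)) \<le> (\<Sum>a\<in>A. exp (- (real (card B) / (50 * real r ^ (2 * 2)))))"
    by (rule sum_mono) (rule p1)
  finally show ?thesis using p0 by simp
qed

text \<open>The patterns \<open>{u, w}\<close>, \<open>{w, v}\<close> are disjoint for distinct
  \<open>w\<close>, so their failures are independent; the test \<open>u \<in> x\<close> tells the
  first edge from the second.\<close>

lemma prob_no_two_path:
  assumes W: "finite W" and fin: "finite D" and uv: "u \<notin> D" "v \<notin> D" "u \<noteq> v"
    and WD: "\<And>w. w \<in> D \<Longrightarrow> {u, w} \<in> W" "\<And>w. w \<in> D \<Longrightarrow> {w, v} \<in> W"
    and st: "s \<in> {1..r}" "t \<in> {1..r}"
  shows "measure_pmf.prob (colouring W r) {c. \<not> (\<exists>w\<in>D. c {u, w} = s \<and> c {w, v} = t)}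
    \<le> exp (- (real (card D) / real r ^ 2))"
proof -
  have "measure_pmf.prob (colouring W r)
      {c. \<forall>w\<in>D. \<not> (\<forall>x\<in>{{u, w}, {w, v}}. c x = (if u \<in> x then s else t))}
    \<le> exp (- (real (card D) / real r ^ 2))"
  proof (rule prob_no_pattern[OF W fin])
    show "disjoint_family_on (\<lambda>w. {{u, w}, {w, v}}) D"
      using uv by (auto simp: disjoint_family_on_def doubleton_eq_iff)
    show "card {{u, w}, {w, v}} \<le> 2" for w by (rule order_trans[OF card_insert_le_m1]) auto
  qed (use WD st in \<open>auto split: if_splits\<close>)
  moreover have "{c. \<not> (\<exists>w\<in>D. c {u, w} = s \<and> c {w, v} = t)} =
      {c. \<forall>w\<in>D. \<not> (\<forall>x\<in>{{u, w}, {w, v}}. c x = (if u \<in> x then s else t))}"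
    using uv by auto
  ultimately show ?thesis by simp
qed

subsection \<open>Uniform random subsets\<close>

lemma Suc_times_binomial_Suc: "Suc k * (n choose Suc k) = (n - k) * (n choose k)"
  by (metis binomial_absorb_comp binomial_absorption)

text \<open>The quotient of the two binomials is a product of factors
  \<open>(n - s - i) / (n - i)\<close>, each at most \<open>1 - s / n\<close>.\<close>

lemma binomial_diff_le:
  assumes "s \<le> n" "m \<le> n"
  shows "real ((n - s) choose m) \<le> (1 - real s / real n) ^ m * real (n choose m)"
  using assms(2)
proof (induction m)
  case (Suc m)
  let ?q = "1 - real s / real n"
  have n: "n > 0" "m < n" using Suc.prems by auto
  have q: "0 \<le> ?q" using assms(1) n by simp
  have "real (Suc m) * real ((n - s) choose Suc m) = real (n - s - m) * real ((n - s) choose m)"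
    using Suc_times_binomial_Suc[of m "n - s"] by (metis of_nat_mult)
  also have "\<dots> \<le> real (n - s - m) * (?q ^ m * real (n choose m))"
    using Suc by (intro mult_left_mono) auto
  also have "\<dots> \<le> (?q * real (n - m)) * (?q ^ m * real (n choose m))"
  proof (rule mult_right_mono)
    have "?q * (real n - real m) = real n - real s - real m + real s * real m / real n"
      using n by (simp add: field_simps)
    then have "real n - real s - real m \<le> ?q * (real n - real m)" by simp
    \<comment> \<open>If \<open>s + m > n\<close>, truncated subtraction makes the left side
      0.\<close>
    then show "real (n - s - m) \<le> ?q * real (n - m)"
      using n q assms(1) by (cases "s + m \<le> n") (auto simp: of_nat_diff)
  qed (use q in auto)
  also have "\<dots> = ?q ^ Suc m * (real (n - m) * real (n choose m))" by simp
  also have "real (n - m) * real (n choose m) = real (Suc m) * real (n choose Suc m)"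
    using Suc_times_binomial_Suc[of m n] by (metis of_nat_mult)
  finally have "real (Suc m) * real ((n - s) choose Suc m) \<le> real (Suc m) * (?q ^ Suc m * real (n choose Suc m))"
    by (simp only: mult_ac)
  then show ?case by (rule mult_left_le_imp_le) simp
qed simp

text \<open>The \<open>m\<close>-sets avoiding \<open>S\<close> are the \<open>m\<close>-subsets of
  \<open>X - S\<close>; the bound on the binomial quotient is followed by
  \<open>1 - x \<le> exp (- x)\<close>.\<close>

lemma prob_nsets_avoid:
  assumes X: "finite X" "S \<subseteq> X" "m \<le> card X"
  shows "measure_pmf.prob (pmf_of_set (nsets X m)) {R. R \<inter> S = {}}
    \<le> exp (- (real m * real (card S) / real (card X)))"
proof -
  let ?q = "1 - real (card S) / real (card X)"
  have ne: "nsets X m \<noteq> {}" "finite (nsets X m)"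
    using X by (auto simp: nsets_eq_empty_iff finite_imp_finite_nsets)
  have S: "card S \<le> card X" using X by (simp add: card_mono)
  have eq: "nsets X m \<inter> {R. R \<inter> S = {}} = nsets (X - S) m"
    unfolding nsets_def by blast
  have pos: "real (card X choose m) > 0" using X(3) by simp
  have "measure_pmf.prob (pmf_of_set (nsets X m)) {R. R \<inter> S = {}}
      = real ((card X - card S) choose m) / real (card X choose m)"
    using X finite_subset[OF X(2,1)] by (simp add: measure_pmf_of_set[OF ne] eq card_nsets card_Diff_subset)
  also have "\<dots> \<le> ?q ^ m"
    using binomial_diff_le[OF S X(3)] pos by (simp add: pos_divide_le_eq)
  also have "\<dots> \<le> exp (- (real (card S) / real (card X))) ^ m"
  proof (rule power_mono)
    show "?q \<le> exp (- (real (card S) / real (card X)))"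
      using exp_ge_add_one_self[of "- (real (card S) / real (card X))"] by simp
    \<comment> \<open>For empty \<open>X\<close> the quotient is 0 by convention, so
      \<open>?q\<close> is 1.\<close>
    show "0 \<le> ?q" using S by (cases "card X = 0") (auto simp: divide_le_eq)
  qed
  finally show ?thesis by (simp add: exp_of_nat_mult[symmetric])
qed

text \<open>For \<open>m \<ge> 2\<close> and \<open>N = card X\<close>, deleting the two elements
  gives the exact value \<open>m (m - 1) / (N (N - 1))\<close>, and
  \<open>(m - 1) / (N - 1) \<le> m / N\<close>. For smaller \<open>m\<close> the event is
  empty.\<close>

lemma prob_nsets_two:
  assumes X: "finite X" "m \<le> card X" and e: "e \<in> X" "e' \<in> X" "e \<noteq> e'"
  shows "measure_pmf.prob (pmf_of_set (nsets X m)) {R. e \<in> R \<and> e' \<in> R}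
    \<le> (real m / real (card X))\<^sup>2"
proof (cases "m \<ge> 2")
  case False
  have "nsets X m \<inter> {R. e \<in> R \<and> e' \<in> R} = {}"
  proof -
    have "card R \<ge> 2" if "finite R" "e \<in> R" "e' \<in> R" for R
      using card_mono[OF that(1), of "{e, e'}"] that e by auto
    then show ?thesis using False unfolding nsets_def by auto
  qed
  moreover have "nsets X m \<noteq> {}" "finite (nsets X m)"
    using X by (auto simp: nsets_eq_empty_iff finite_imp_finite_nsets)
  ultimately show ?thesis by (simp add: measure_pmf_of_set)
next
  case True
  then obtain k where k: "m = Suc (Suc k)" by (metis add_2_eq_Suc le_Suc_ex)
  have ne: "nsets X m \<noteq> {}" "finite (nsets X m)"
    using X by (auto simp: nsets_eq_empty_iff finite_imp_finite_nsets)
  obtain N where N: "card X = Suc (Suc N)" using X(2) k by (metis Suc_le_D Suc_le_mono)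
  have "nsets X m \<inter> {R. e \<in> R \<and> e' \<in> R} = (\<lambda>R. insert e (insert e' R)) ` nsets (X - {e, e'}) k"
  proof (intro equalityI subsetI)
    fix R assume R: "R \<in> nsets X m \<inter> {R. e \<in> R \<and> e' \<in> R}"
    then have "R - {e, e'} \<in> nsets (X - {e, e'}) k"
      using e k by (auto simp: nsets_def card_Diff_subset)
    moreover have "R = insert e (insert e' (R - {e, e'}))" using R by auto
    ultimately show "R \<in> (\<lambda>R. insert e (insert e' R)) ` nsets (X - {e, e'}) k" by blast
  next
    fix R assume "R \<in> (\<lambda>R. insert e (insert e' R)) ` nsets (X - {e, e'}) k"
    then obtain R' where R': "R' \<in> nsets (X - {e, e'}) k" "R = insert e (insert e' R')" by blast
    then have "e \<notin> R'" "e' \<notin> R'" by (auto simp: nsets_def)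
    then show "R \<in> nsets X m \<inter> {R. e \<in> R \<and> e' \<in> R}"
      using R' e k by (auto simp: nsets_def)
  qed
  then have "card (nsets X m \<inter> {R. e \<in> R \<and> e' \<in> R}) \<le> card (nsets (X - {e, e'}) k)"
    using X by (simp del: card_nsets add: card_image_le finite_imp_finite_nsets)
  also have "\<dots> = N choose k"
    using X e N by (simp add: card_nsets card_Diff_subset)
  finally have c: "card (nsets X m \<inter> {R. e \<in> R \<and> e' \<in> R}) \<le> N choose k" .
  have "Suc (Suc k) * (Suc k * (Suc (Suc N) choose Suc (Suc k))) = Suc (Suc N) * (Suc N * (N choose k))"
    using Suc_times_binomial_eq[of "Suc N" "Suc k"] Suc_times_binomial_eq[of N k]
    by (metis mult.commute mult.left_commute)
  then have id: "real (Suc (Suc k)) * (real (Suc k) * real (Suc (Suc N) choose Suc (Suc k)))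
      = real (Suc (Suc N)) * (real (Suc N) * real (N choose k))"
    by (metis of_nat_mult)
  have "k \<le> N" using X k N by simp
  then have pos: "real (Suc (Suc N) choose Suc (Suc k)) > 0" by (simp del: binomial_Suc_Suc)
  have "measure_pmf.prob (pmf_of_set (nsets X m)) {R. e \<in> R \<and> e' \<in> R}
      \<le> real (N choose k) / real (Suc (Suc N) choose Suc (Suc k))"
    unfolding measure_pmf_of_set[OF ne] using c pos N k
    by (simp add: divide_right_mono del: binomial_Suc_Suc)
  also have "\<dots> = (real (Suc (Suc k)) / real (Suc (Suc N))) * (real (Suc k) / real (Suc N))"
    using id pos by (simp add: field_simps del: of_nat_Suc binomial_Suc_Suc)
  also have "\<dots> \<le> (real (Suc (Suc k)) / real (Suc (Suc N))) * (real (Suc (Suc k)) / real (Suc (Suc N)))"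
    using \<open>k \<le> N\<close> by (intro mult_left_mono) (auto simp: field_simps)
  finally show ?thesis using k N by (simp add: power2_eq_square)
qed

subsection \<open>Separating random edges from colours\<close>

text \<open>Draw the second coordinate first: an exceptional value in \<open>Y\<close> contributes
  at most 1, any other at most \<open>q\<close>. It serves to fix the colouring and then draw
  \<open>R\<close>.\<close>

lemma prob_pair_pmf_le:
  assumes "\<And>y. y \<in> set_pmf B \<Longrightarrow> y \<notin> Y \<Longrightarrow> measure_pmf.prob A {x. (x, y) \<in> Z} \<le> q" and q: "0 \<le> q"
  shows "measure_pmf.prob (pair_pmf A B) Z \<le> measure_pmf.prob B Y + q"
proof -
  have eq: "pair_pmf A B = bind_pmf B (\<lambda>y. map_pmf (\<lambda>x. (x, y)) A)"
    unfolding pair_pmf_def map_pmf_def by (rule bind_commute_pmf)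
  have "emeasure (pair_pmf A B) Z = (\<integral>\<^sup>+ y. emeasure A {x. (x, y) \<in> Z} \<partial>B)"
    unfolding eq by (simp add: vimage_def)
  also have "\<dots> \<le> (\<integral>\<^sup>+ y. indicator Y y + ennreal q \<partial>B)"
  proof (rule nn_integral_mono_AE, unfold AE_measure_pmf_iff, rule ballI)
    fix y assume y: "y \<in> set_pmf B"
    show "emeasure A {x. (x, y) \<in> Z} \<le> indicator Y y + ennreal q"
    proof (cases "y \<in> Y")
      case True
      have "emeasure A {x. (x, y) \<in> Z} \<le> 1" by (rule measure_pmf.emeasure_le_1)
      then show ?thesis using True by (simp add: add_increasing2)
    next
      case False
      then show ?thesis using assms(1)[OF y] by (simp add: measure_pmf.emeasure_eq_measure ennreal_leI)
    qed
  qed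
  also have "\<dots> = emeasure B Y + ennreal q"
    by (simp add: nn_integral_add)
  also have "\<dots> = ennreal (measure_pmf.prob B Y + q)"
    using q by (simp add: measure_pmf.emeasure_eq_measure)
  finally show ?thesis
    unfolding measure_pmf.emeasure_eq_measure using q by (subst (asm) ennreal_le_iff) auto
qed

text \<open>Colouring all pairs and forgetting the colours of non-edges has the same law as
  colouring only the edges. This makes \<open>R\<close> and the colouring independent.\<close>

lemma random_coloured_graph_pair:
  assumes E: "E \<subseteq> nsets {1..n} 2" and m: "m \<le> card (non_edges n E)"
  shows "random_coloured_graph n E m r =
    map_pmf (\<lambda>(R, c). (E \<union> R, \<lambda>x. if x \<in> E \<union> R then c x else 0))
      (pair_pmf (pmf_of_set (nsets (non_edges n E) m)) (colouring (nsets {1..n} 2) r))"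
proof -
  let ?W = "nsets {1..n} (2::nat)"
  let ?P = "pmf_of_set (nsets (non_edges n E) m)"
  have W: "finite ?W" by (simp add: finite_imp_finite_nsets)
  then have fin: "finite (non_edges n E)" by (simp add: non_edges_def)
  have ne: "nsets (non_edges n E) m \<noteq> {}" "finite (nsets (non_edges n E) m)"
    using m fin by (auto simp: nsets_eq_empty_iff finite_imp_finite_nsets)
  have "random_coloured_graph n E m r =
    bind_pmf ?P (\<lambda>R. map_pmf (\<lambda>c. (E \<union> R, \<lambda>x. if x \<in> E \<union> R then c x else 0)) (colouring ?W r))"
    unfolding random_coloured_graph_def
  proof (rule bind_pmf_cong[OF refl])
    fix R assume "R \<in> set_pmf ?P"
    then have "R \<subseteq> ?W" using ne by (auto simp: nsets_def non_edges_def)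
    then have "E \<union> R \<subseteq> ?W" using E by blast
    from Pi_pmf_subset[OF W this, of 0 "\<lambda>_. pmf_of_set {1..r}"]
    show "map_pmf (\<lambda>c. (E \<union> R, c)) (Pi_pmf (E \<union> R) 0 (\<lambda>_. pmf_of_set {1..r})) =
        map_pmf (\<lambda>c. (E \<union> R, \<lambda>x. if x \<in> E \<union> R then c x else 0)) (colouring ?W r)"
      unfolding colouring_def by (simp add: pmf.map_comp o_def)
  qed
  also have "\<dots> = map_pmf (\<lambda>(R, c). (E \<union> R, \<lambda>x. if x \<in> E \<union> R then c x else 0))
      (pair_pmf ?P (colouring ?W r))"
    unfolding pair_pmf_def map_pmf_def by (simp add: bind_assoc_pmf bind_return_pmf)
  finally show ?thesis .
qed

lemma rainbow_connected_restrict: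
  "rainbow_connected n (E, \<lambda>x. if x \<in> E then c x else 0) \<longleftrightarrow> rainbow_connected n (E, c)"
proof -
  have "rainbow (\<lambda>x. if x \<in> E then c x else 0) p \<longleftrightarrow> rainbow c p" if "is_path n E u p v" for u p v
  proof -
    have "set (path_edges p) \<subseteq> E" using that unfolding is_path_def by blast
    then have "map (\<lambda>x. if x \<in> E then c x else 0) (path_edges p) = map c (path_edges p)" by auto
    then show ?thesis by (simp only: rainbow_def)
  qed
  then show ?thesis unfolding rainbow_connected_def by (simp cong: conj_cong)
qed

lemma prob_rainbow_connected:
  assumes E: "E \<subseteq> nsets {1..n} 2" and m: "m \<le> card (non_edges n E)"
  shows "measure_pmf.prob (random_coloured_graph n E m r) {G. rainbow_connected n G} =
    measure_pmf.prob (pair_pmf (pmf_of_set (nsets (non_edges n E) m)) (colouring (nsets {1..n} 2) r))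
      {(R, c). rainbow_connected n (E \<union> R, c)}"
proof -
  have "(\<lambda>(R, c). (E \<union> R, \<lambda>x. if x \<in> E \<union> R then c x else 0)) -` {G. rainbow_connected n G} =
      {(R, c). rainbow_connected n (E \<union> R, c)}"
    using rainbow_connected_restrict by (auto simp del: Un_iff)
  then show ?thesis
    unfolding random_coloured_graph_pair[OF assms] by simp
qed

subsection \<open>Short rainbow walks in dense graphs\<close>

definition nbrs :: "nat set set \<Rightarrow> nat \<Rightarrow> nat set" where
  "nbrs E v = {w. {v, w} \<in> E}"

lemma nbrs_subset: "E \<subseteq> nsets {1..n} 2 \<Longrightarrow> nbrs E v \<subseteq> {1..n} - {v}"
proof
  fix w assume "E \<subseteq> nsets {1..n} 2" "w \<in> nbrs E v"
  then have "{v, w} \<in> nsets {1..n} 2" unfolding nbrs_def by blast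
  then show "w \<in> {1..n} - {v}" by simp
qed

lemma finite_nbrs: "E \<subseteq> nsets {1..n} 2 \<Longrightarrow> finite (nbrs E v)"
  using nbrs_subset[of E n v] by (meson finite_Diff finite_atLeastAtMost finite_subset)

lemma degree_eq_card_nbrs:
  assumes "E \<subseteq> nsets {1..n} 2"
  shows "degree E v = card (nbrs E v)"
proof -
  have "bij_betw (\<lambda>w. {v, w}) (nbrs E v) {e \<in> E. v \<in> e}"
  proof (rule bij_betwI')
    fix e assume e: "e \<in> {e \<in> E. v \<in> e}"
    then obtain a b where "e = {a, b}" using assms by (blast elim: nsets2_E)
    then show "\<exists>w\<in>nbrs E v. e = {v, w}"
      using e unfolding nbrs_def by (auto simp: insert_commute)
  qed (auto simp: nbrs_def doubleton_eq_iff)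
  then show ?thesis unfolding degree_def by (simp add: bij_betw_same_card)
qed

lemma dense_graphs_iff:
  assumes "n \<ge> 1"
  shows "E \<in> dense_graphs n \<delta> \<longleftrightarrow>
    E \<subseteq> nsets {1..n} 2 \<and> (\<forall>v\<in>{1..n}. \<delta> * real n \<le> real (card (nbrs E v)))"
proof -
  have "min_degree n E \<in> degree E ` {1..n}" unfolding min_degree_def
    using assms by (intro Min_in) auto
  then obtain w where w: "w \<in> {1..n}" "min_degree n E = degree E w" by blast
  have "min_degree n E \<le> degree E v" if "v \<in> {1..n}" for v
    unfolding min_degree_def using that by (intro Min_le) auto
  then have "\<delta> * real n \<le> real (min_degree n E) \<longleftrightarrow>
      (\<forall>v\<in>{1..n}. \<delta> * real n \<le> real (degree E v))"
    using w by (metis of_nat_mono order_trans)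
  then show ?thesis unfolding dense_graphs_def by (auto simp: degree_eq_card_nbrs)
qed

lemma reach_mono: "reach E c C u v \<Longrightarrow> E \<subseteq> E' \<Longrightarrow> reach E' c C u v"
  unfolding reach_def by blast

definition graph_pmf :: "nat \<Rightarrow> nat set set \<Rightarrow> nat \<Rightarrow> nat \<Rightarrow> (nat set set \<times> (nat set \<Rightarrow> nat)) pmf" where
  "graph_pmf n E m r =
     pair_pmf (pmf_of_set (nsets (non_edges n E) m)) (colouring (nsets {1..n} 2) r)"

lemma finite_non_edges: "finite (non_edges n E)"
  by (simp add: non_edges_def finite_imp_finite_nsets)

lemma set_pmf_nsets:
  "m \<le> card (non_edges n E) \<Longrightarrow> set_pmf (pmf_of_set (nsets (non_edges n E) m)) = nsets (non_edges n E) m"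
  using finite_non_edges[of n E]
  by (intro set_pmf_of_set) (auto simp: nsets_eq_empty_iff finite_imp_finite_nsets)

text \<open>Leaves a deterministic task, connectivity outside a bad event \<open>F\<close>, and a
  bound on \<open>F\<close>. Only sets \<open>R\<close> of non-edges matter, since any other has
  probability 0.\<close>

lemma prob_rainbow_connected_ge:
  assumes E: "E \<subseteq> nsets {1..n} 2" and m: "m \<le> card (non_edges n E)"
    and F: "\<And>R c. R \<subseteq> non_edges n E \<Longrightarrow> (R, c) \<notin> F \<Longrightarrow> rainbow_connected n (E \<union> R, c)"
    and q: "measure_pmf.prob (graph_pmf n E m r) F \<le> q"
  shows "1 - q \<le> measure_pmf.prob (random_coloured_graph n E m r) {G. rainbow_connected n G}"
proof -
  let ?M = "graph_pmf n E m r"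
  let ?S = "{(R, c). rainbow_connected n (E \<union> R, c)}"
  have "measure_pmf.prob ?M (- ?S) \<le> measure_pmf.prob ?M F"
  proof (rule measure_pmf.finite_measure_mono_AE)
    show "AE x in ?M. x \<in> - ?S \<longrightarrow> x \<in> F"
      unfolding AE_measure_pmf_iff graph_pmf_def set_pair_pmf set_pmf_nsets[OF m]
      using F by (auto simp: nsets_def)
  qed simp
  moreover have "measure_pmf.prob ?M (- ?S) = 1 - measure_pmf.prob ?M ?S"
    using measure_pmf.prob_compl[of ?S ?M] by (simp add: Compl_eq_Diff_UNIV)
  ultimately show ?thesis using q
    unfolding prob_rainbow_connected[OF E m] graph_pmf_def by linarith
qed

text \<open>The walk uses edges of \<open>E\<close> only, so once the colouring is good no choice of
  \<open>R\<close> can fail; this is the summand 0 in the proof.\<close>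

lemma prob_not_reach_two:
  assumes E: "E \<subseteq> nsets {1..n} 2" and uv: "u \<in> {1..n}" "v \<in> {1..n}" "u \<noteq> v"
    and st: "s \<in> {1..r}" "t \<in> {1..r}" "s \<noteq> t" and D: "x \<le> real (card (nbrs E u \<inter> nbrs E v))"
  shows "measure_pmf.prob (graph_pmf n E m r) {(R, c). \<not> reach (E \<union> R) c {s, t} u v}
    \<le> exp (- (x / real r ^ 2))"
proof -
  let ?W = "nsets {1..n} (2::nat)"
  let ?D = "nbrs E u \<inter> nbrs E v"
  let ?Y = "{c. \<not> (\<exists>w\<in>?D. c {u, w} = s \<and> c {w, v} = t)}"
  have "measure_pmf.prob (graph_pmf n E m r) {(R, c). \<not> reach (E \<union> R) c {s, t} u v}
      \<le> measure_pmf.prob (colouring ?W r) ?Y + 0"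
    unfolding graph_pmf_def
  proof (rule prob_pair_pmf_le)
    fix c assume "c \<notin> ?Y"
    then obtain w where w: "w \<in> ?D" "c {u, w} = s" "c {w, v} = t" by blast
    then have e: "{u, w} \<in> E" "{w, v} \<in> E" by (auto simp: nbrs_def insert_commute)
    have "reach E c ({s} \<union> {t}) u v"
      by (rule reach_trans[OF reach_edge[OF e(1)] reach_edge[OF e(2)]]) (use w st in auto)
    then have "reach (E \<union> R) c {s, t} u v" for R
      using reach_mono[of E c "{s, t}" u v "E \<union> R"] by (simp add: insert_commute)
    then show "measure_pmf.prob (pmf_of_set (nsets (non_edges n E) m))
        {R. (R, c) \<in> {(R, c). \<not> reach (E \<union> R) c {s, t} u v}} \<le> 0" by simp
  qed simp
  also have "measure_pmf.prob (colouring ?W r) ?Y \<le> exp (- (real (card ?D) / real r ^ 2))"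
  proof (rule prob_no_two_path)
    show "finite ?W" by (simp add: finite_imp_finite_nsets)
    show "finite ?D" using finite_nbrs[OF E] by blast
    show "u \<notin> ?D" "v \<notin> ?D" using nbrs_subset[OF E] by blast+
    show "{u, w} \<in> ?W" "{w, v} \<in> ?W" if "w \<in> ?D" for w
      using that nbrs_subset[OF E, of u] nbrs_subset[OF E, of v] uv by auto
  qed (use uv st in auto)
  also have "\<dots> \<le> exp (- (x / real r ^ 2))" using D by (simp add: divide_right_mono)
  finally show ?thesis by simp
qed


section \<open>Three-edge walks whose middle edge may be random\<close>

lemma card_non_edges_le: "real (card (non_edges n E)) \<le> real n ^ 2 / 2"
proof -
  have "card (non_edges n E) \<le> card (nsets {1..n} 2)"
    unfolding non_edges_def by (intro card_mono) (auto simp: finite_imp_finite_nsets)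
  then have "card (non_edges n E) \<le> n * (n - 1) div 2" by (simp add: choose_two)
  then have "2 * card (non_edges n E) \<le> n * (n - 1)" by linarith
  also have "\<dots> \<le> n ^ 2" by (simp add: power2_eq_square)
  finally have "real (2 * card (non_edges n E)) \<le> real (n ^ 2)" by (rule of_nat_mono)
  then show ?thesis by simp
qed

lemma reach_mid_edge:
  assumes "e \<in> mid_edges c u A B v" "e \<in> E'" "\<And>a. a \<in> A \<Longrightarrow> {u, a} \<in> E'" "\<And>b. b \<in> B \<Longrightarrow> {b, v} \<in> E'"
  shows "reach E' c {1, 2, 3} u v"
proof -
  obtain a b where ab: "e = {a, b}" "a \<in> A" "b \<in> B" "c {u, a} = 1" "c {a, b} = 2" "c {b, v} = 3"
    using assms(1) unfolding mid_edges_def by blast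
  have "reach E' c ({1} \<union> {2}) u b"
    by (rule reach_trans[OF reach_edge[OF assms(3)[OF ab(2)]] reach_edge]) (use ab assms in auto)
  then have "reach E' c (({1} \<union> {2}) \<union> {3}) u v"
    by (rule reach_trans[OF _ reach_edge[OF assms(4)[OF ab(3)]]]) (use ab in auto)
  moreover have "({1} \<union> {2}) \<union> {3} = {1, 2, 3 :: nat}" by auto
  ultimately show ?thesis by simp
qed

text \<open>The first two summands bound the colourings with too few middle edges. For the others,
  either some middle edge lies in \<open>E\<close> and success is certain, or all are non-edges and
  failure forces \<open>R\<close> to avoid every one of them, which gives the third summand.\<close>

lemma prob_not_reach_three:
  assumes E: "E \<subseteq> nsets {1..n} 2" and m: "m \<le> card (non_edges n E)"
    and uv: "u \<in> {1..n}" "v \<in> {1..n}" "u \<noteq> v"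
    and r: "r \<ge> 3" and d: "0 < \<delta>" "1 \<le> \<delta> * real n / 20"
    and deg: "\<delta> * real n \<le> real (card (nbrs E u))" "\<delta> * real n \<le> real (card (nbrs E v))"
    and few: "real (card (nbrs E u \<inter> nbrs E v)) \<le> \<delta> * real n / 20"
  shows "measure_pmf.prob (graph_pmf n E m r) {(R, c). \<not> reach (E \<union> R) c {1, 2, 3} u v}
    \<le> exp (- (\<delta> * real n / (60 * real r ^ 2))) + real n * exp (- (\<delta> * real n / (60 * real r ^ 4)))
       + exp (- (13 / 10 * \<delta>\<^sup>2 * real m / real r ^ 3))"
proof -
  let ?W = "nsets {1..n} (2::nat)"
  define A where "A = nbrs E u - nbrs E v - {v}"
  define B where "B = nbrs E v - nbrs E u - {u}"
  have fin: "finite A" "finite B" unfolding A_def B_def using finite_nbrs[OF E] by auto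
  have sub: "A \<subseteq> {1..n}" "B \<subseteq> {1..n}" "u \<notin> A" "v \<notin> B" "v \<notin> A" "u \<notin> B" "A \<inter> B = {}"
    unfolding A_def B_def using nbrs_subset[OF E] by blast+
  \<comment> \<open>The common neighbours cost at most \<delta> n / 20, and the single vertex
    \<open>w\<close> costs 1, again at most \<delta> n / 20.\<close>
  have large: "9 / 10 * \<delta> * real n \<le> real (card (N - N' - {w}))"
    if "\<delta> * real n \<le> real (card N)" "real (card (N \<inter> N')) \<le> \<delta> * real n / 20" "finite N" for N N' w
  proof -
    have "N \<subseteq> (N - N' - {w}) \<union> (N \<inter> N') \<union> {w}" by blast
    then have "card N \<le> card ((N - N' - {w}) \<union> (N \<inter> N') \<union> {w})"
      using that by (intro card_mono) auto
    also have "\<dots> \<le> card (N - N' - {w}) + card (N \<inter> N') + 1"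
      using card_Un_le[of "(N - N' - {w}) \<union> (N \<inter> N')" "{w}"] card_Un_le[of "N - N' - {w}" "N \<inter> N'"]
      by simp
    finally have "real (card N) \<le> real (card (N - N' - {w})) + real (card (N \<inter> N')) + 1" by linarith
    then show ?thesis using that d by simp
  qed
  have cA: "9 / 10 * \<delta> * real n \<le> real (card A)"
    unfolding A_def by (rule large[OF deg(1) few]) (rule finite_nbrs[OF E])
  have cB: "9 / 10 * \<delta> * real n \<le> real (card B)"
    unfolding B_def by (rule large[OF deg(2)]) (use few finite_nbrs[OF E] in \<open>auto simp: Int_commute\<close>)
  have cAn: "card A \<le> n" using card_mono[OF _ sub(1)] by simp
  have n: "real n > 0" using uv by simp
  \<comment> \<open>The constant 60 is a rounding: 9/10 divided by 50 exceeds 1/60.\<close>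
  have exponent: "\<delta> * real n / (60 * real r ^ p) \<le> x / (50 * real r ^ p)"
    if "9 / 10 * \<delta> * real n \<le> x" for x p
  proof -
    have "\<delta> * real n / 60 \<le> x / 50" using that d by simp
    then have "\<delta> * real n / 60 / real r ^ p \<le> x / 50 / real r ^ p" by (rule divide_right_mono) simp
    then show ?thesis by simp
  qed
  define s0 where "s0 = 81 / 100 * real (card A) * real (card B) / real r ^ 3"
  define Y where "Y = {c. real (card (mid_edges c u A B v)) < s0}"
  \<comment> \<open>\<open>(81 / 100) (9 / 10)\<^sup>2 > 65 / 100\<close>; dividing by the at most \<open>n\<^sup>2 / 2\<close> non-edges yields \<open>13 / 10\<close>.\<close>
  have s0: "65 / 100 * \<delta>\<^sup>2 * real n ^ 2 / real r ^ 3 \<le> s0"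
  proof -
    have "65 / 100 * \<delta>\<^sup>2 * real n ^ 2 \<le> 81 / 100 * ((9 / 10 * \<delta> * real n) * (9 / 10 * \<delta> * real n))"
      using d by (simp add: power2_eq_square)
    also have "\<dots> \<le> 81 / 100 * (real (card A) * real (card B))"
      by (intro mult_left_mono mult_mono cA cB) (use d n in auto)
    also have "81 / 100 * (real (card A) * real (card B)) = 81 / 100 * real (card A) * real (card B)"
      by simp
    finally have "65 / 100 * \<delta>\<^sup>2 * real n ^ 2 / real r ^ 3 \<le> 81 / 100 * real (card A) * real (card B) / real r ^ 3"
      by (rule divide_right_mono[OF _ zero_le_power[OF of_nat_0_le_iff]])
    then show ?thesis unfolding s0_def .
  qed
  have "measure_pmf.prob (graph_pmf n E m r) {(R, c). \<not> reach (E \<union> R) c {1, 2, 3} u v}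
      \<le> measure_pmf.prob (colouring ?W r) Y + exp (- (13 / 10 * \<delta>\<^sup>2 * real m / real r ^ 3))"
    unfolding graph_pmf_def
  proof (rule prob_pair_pmf_le)
    fix c assume "c \<notin> Y"
    let ?S = "mid_edges c u A B v"
    let ?NE = "non_edges n E"
    have S: "s0 \<le> real (card ?S)" using \<open>c \<notin> Y\<close> unfolding Y_def by simp
    have re: "reach (E \<union> R) c {1, 2, 3} u v" if "e \<in> ?S" "e \<in> E \<union> R" for e R
      by (rule reach_mid_edge[OF that]) (auto simp: A_def B_def nbrs_def insert_commute)
    show "measure_pmf.prob (pmf_of_set (nsets ?NE m))
        {R. (R, c) \<in> {(R, c). \<not> reach (E \<union> R) c {1, 2, 3} u v}}
        \<le> exp (- (13 / 10 * \<delta>\<^sup>2 * real m / real r ^ 3))" (is "?P {R. ?Q R} \<le> _")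
    proof (cases "?S \<inter> E = {}")
      case False
      then obtain e where e: "e \<in> ?S" "e \<in> E" by blast
      then have "{R. ?Q R} = {}" using re[OF e(1)] by auto
      then show ?thesis by simp
    next
      case True
      have "?S \<subseteq> ?W"
      proof
        fix e assume "e \<in> ?S"
        then obtain a b where "e = {a, b}" "a \<in> A" "b \<in> B" unfolding mid_edges_def by blast
        then show "e \<in> ?W" using sub by auto
      qed
      then have SN: "?S \<subseteq> ?NE" using True unfolding non_edges_def by blast
      have "?P {R. ?Q R} \<le> ?P {R. R \<inter> ?S = {}}"
        using re by (intro measure_pmf.finite_measure_mono) auto
      also have "\<dots> \<le> exp (- (real m * real (card ?S) / real (card ?NE)))"
        by (rule prob_nsets_avoid[OF finite_non_edges SN m])
      also have "\<dots> \<le> exp (- (13 / 10 * \<delta>\<^sup>2 * real m / real r ^ 3))"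
      proof -
        \<comment> \<open>The denominator has to be positive: the count of middle edges is positive,
          and here they are all non-edges.\<close>
        have "0 < 65 / 100 * \<delta>\<^sup>2 * real n ^ 2 / real r ^ 3" using d n r by simp
        then have "0 < real (card ?S)" using s0 S by linarith
        then have pos: "0 < real (card ?NE)"
          using card_mono[OF finite_non_edges SN] by linarith
        have "13 / 10 * \<delta>\<^sup>2 * real m / real r ^ 3 = real m * (65 / 100 * \<delta>\<^sup>2 * real n ^ 2 / real r ^ 3) / (real n ^ 2 / 2)"
          using n by (simp add: field_simps)
        also have "\<dots> \<le> real m * real (card ?S) / (real n ^ 2 / 2)"
          using s0 S n by (intro divide_right_mono mult_left_mono) auto
        also have "\<dots> \<le> real m * real (card ?S) / real (card ?NE)"
          using pos n by (intro divide_left_mono card_non_edges_le) auto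
        finally show ?thesis by simp
      qed
      finally show ?thesis .
    qed
  qed simp
  also have "measure_pmf.prob (colouring ?W r) Y
      \<le> exp (- (real (card A) / (50 * real r ^ 2))) + real (card A) * exp (- (real (card B) / (50 * real r ^ 4)))"
    unfolding Y_def s0_def
  proof (rule prob_few_mid_edges)
    show "finite ?W" by (simp add: finite_imp_finite_nsets)
    show "{u, a} \<in> ?W" if "a \<in> A" for a using that sub uv by auto
    show "{b, v} \<in> ?W" if "b \<in> B" for b using that sub uv by auto
    show "{a, b} \<in> ?W" if "a \<in> A" "b \<in> B" for a b using that sub by auto
  qed (use fin sub r in auto)
  also have "exp (- (real (card A) / (50 * real r ^ 2))) \<le> exp (- (\<delta> * real n / (60 * real r ^ 2)))"
    using exponent[OF cA] by simp
  also have "real (card A) * exp (- (real (card B) / (50 * real r ^ 4)))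
      \<le> real n * exp (- (\<delta> * real n / (60 * real r ^ 4)))"
    using exponent[OF cB] cAn by (intro mult_mono) simp_all
  finally show ?thesis by simp
qed

text \<open>Take \<open>X\<close> largest such that the neighbourhoods overlap little and their
  union has at least \<delta> n / 2 elements per member. The union has at most \<open>n\<close>
  elements, so \<open>card X\<close> is at most 2 / \<delta>. By maximality any other vertex shares
  at least \<delta> n / 20 neighbours with the union, and by pigeonhole at least \<delta>^2 n / 40
  with one member.\<close>

lemma exists_net:
  assumes E: "E \<subseteq> nsets {1..n} 2" and n: "n \<ge> 1" and d: "0 < \<delta>"
    and deg: "\<And>v. v \<in> {1..n} \<Longrightarrow> \<delta> * real n \<le> real (card (nbrs E v))"
  shows "\<exists>X\<subseteq>{1..n}. real (card X) \<le> 2 / \<delta> \<and>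
    (\<forall>x\<in>X. \<forall>y\<in>X. x \<noteq> y \<longrightarrow> real (card (nbrs E x \<inter> nbrs E y)) \<le> \<delta> * real n / 20) \<and>
    (\<forall>v\<in>{1..n} - X. \<exists>x\<in>X. \<delta>\<^sup>2 * real n / 40 \<le> real (card (nbrs E v \<inter> nbrs E x)))"
proof -
  let ?U = "\<lambda>X. \<Union>x\<in>X. nbrs E x"
  define P where "P X \<longleftrightarrow> X \<subseteq> {1..n} \<and> real (card X) * (\<delta> * real n / 2) \<le> real (card (?U X)) \<and>
    (\<forall>x\<in>X. \<forall>y\<in>X. x \<noteq> y \<longrightarrow> real (card (nbrs E x \<inter> nbrs E y)) \<le> \<delta> * real n / 20)" for X
  have "P {}" unfolding P_def by simp
  moreover have "card X \<le> n" if "P X" for X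
    using that card_mono[of "{1..n}" X] unfolding P_def by simp
  ultimately have "\<exists>X. P X \<and> (\<forall>Y. P Y \<longrightarrow> card Y \<le> card X)"
    by (intro ex_has_greatest_nat[of P "{}" card "Suc n"]) (auto simp: less_Suc_eq_le)
  then obtain X where PX: "P X" and mx: "\<And>Y. P Y \<Longrightarrow> card Y \<le> card X"
    by metis
  have X: "X \<subseteq> {1..n}" "finite X" using PX unfolding P_def by (auto intro: finite_subset)
  have finU: "finite (?U Y)" if "finite Y" for Y using that finite_nbrs[OF E] by blast
  have dn: "\<delta> * real n > 0" using d n by simp
  have cU: "real (card X) * (\<delta> * real n / 2) \<le> real (card (?U X))" using PX unfolding P_def by blast
  have "?U X \<subseteq> {1..n}" using nbrs_subset[OF E] by blast
  then have "card (?U X) \<le> n" using card_mono[of "{1..n}" "?U X"] by simp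
  then have "real (card X) * (\<delta> * real n / 2) \<le> real n" using cU by linarith
  then have k: "real (card X) \<le> 2 / \<delta>" using d n by (simp add: field_simps)
  have cov: "\<exists>x\<in>X. \<delta>\<^sup>2 * real n / 40 \<le> real (card (nbrs E v \<inter> nbrs E x))"
    if v: "v \<in> {1..n}" "v \<notin> X" for v
  proof -
    have big: "\<delta> * real n / 20 \<le> real (card (nbrs E v \<inter> ?U X))"
    proof (rule ccontr)
      assume neg: "\<not> \<delta> * real n / 20 \<le> real (card (nbrs E v \<inter> ?U X))"
      have "P (insert v X)" unfolding P_def
      proof (intro conjI ballI impI)
        show "insert v X \<subseteq> {1..n}" using v X by blast
        have "card (nbrs E v \<union> ?U X) + card (nbrs E v \<inter> ?U X) = card (nbrs E v) + card (?U X)"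
          using card_Un_Int[OF finite_nbrs[OF E] finU[OF X(2)]] by simp
        then have "real (card (nbrs E v \<union> ?U X)) + real (card (nbrs E v \<inter> ?U X))
            = real (card (nbrs E v)) + real (card (?U X))" by linarith
        moreover have "\<delta> * real n \<le> real (card (nbrs E v))" using deg v by blast
        \<comment> \<open>A vertex sharing fewer than \<delta> n / 20 neighbours with the union
          enlarges it by more than \<delta> n / 2, so it could be added to \<open>X\<close>.\<close>
        ultimately have "\<delta> * real n / 2 + real (card X) * (\<delta> * real n / 2) \<le> real (card (nbrs E v \<union> ?U X))"
          using neg cU dn by linarith
        then show "real (card (insert v X)) * (\<delta> * real n / 2) \<le> real (card (?U (insert v X)))"
          using v X by (simp add: algebra_simps)
        fix x y assume xy: "x \<in> insert v X" "y \<in> insert v X" "x \<noteq> y"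
        have small: "real (card (nbrs E v \<inter> nbrs E z)) \<le> \<delta> * real n / 20" if "z \<in> X" for z
        proof -
          have "card (nbrs E v \<inter> nbrs E z) \<le> card (nbrs E v \<inter> ?U X)"
            using that finite_nbrs[OF E] by (intro card_mono) auto
          then show ?thesis using neg by linarith
        qed
        show "real (card (nbrs E x \<inter> nbrs E y)) \<le> \<delta> * real n / 20"
          using xy small[of x] small[of y] PX unfolding P_def by (auto simp: Int_commute)
      qed
      from mx[OF this] show False using v X by simp
    qed
    show ?thesis
    proof (rule ccontr)
      assume "\<not> ?thesis"
      then have lt: "real (card (nbrs E v \<inter> nbrs E x)) < \<delta>\<^sup>2 * real n / 40" if "x \<in> X" for x
        using that by auto
      have ne: "X \<noteq> {}" using big dn by auto
      have eq: "nbrs E v \<inter> ?U X = (\<Union>x\<in>X. nbrs E v \<inter> nbrs E x)" by blast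
      have "card (nbrs E v \<inter> ?U X) \<le> (\<Sum>x\<in>X. card (nbrs E v \<inter> nbrs E x))"
        unfolding eq by (rule card_UN_le[OF X(2)])
      then have "real (card (nbrs E v \<inter> ?U X)) \<le> (\<Sum>x\<in>X. real (card (nbrs E v \<inter> nbrs E x)))"
        by (simp flip: of_nat_sum)
      also have "\<dots> < (\<Sum>x\<in>X. \<delta>\<^sup>2 * real n / 40)"
        by (rule sum_strict_mono[OF X(2) ne lt])
      also have "\<dots> = real (card X) * (\<delta>\<^sup>2 * real n / 40)" by simp
      also have "\<dots> \<le> 2 / \<delta> * (\<delta>\<^sup>2 * real n / 40)" using k by (intro mult_right_mono) auto
      also have "\<dots> = \<delta> * real n / 20" using d by (simp add: power2_eq_square)
      finally show False using big by simp
    qed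
  qed
  show ?thesis
    using X(1) k cov PX unfolding P_def by (intro exI[of _ X]) simp
qed

section \<open>Tools for limits and union bounds\<close>

lemma whpI:
  assumes "\<forall>\<^sub>F n in sequentially. 1 - f n \<le> measure_pmf.prob (M n) {x. P n x}" "f \<longlonglongrightarrow> 0"
  shows "whp M P"
  unfolding whp_def
proof (rule tendsto_sandwich[OF assms(1)])
  show "\<forall>\<^sub>F n in sequentially. measure_pmf.prob (M n) {x. P n x} \<le> 1" by simp
  show "(\<lambda>n. 1 - f n) \<longlonglongrightarrow> 1" using tendsto_diff[OF tendsto_const assms(2), of 1] by simp
qed simp

lemma prob_UN_le:
  assumes "finite I" "\<And>i. i \<in> I \<Longrightarrow> measure_pmf.prob M (F i) \<le> b" "real (card I) \<le> k" "0 \<le> b"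
  shows "measure_pmf.prob M (\<Union>i\<in>I. F i) \<le> k * b"
proof -
  have "measure_pmf.prob M (\<Union>i\<in>I. F i) \<le> (\<Sum>i\<in>I. measure_pmf.prob M (F i))"
    by (rule measure_UNION_le[OF assms(1)]) auto
  also have "\<dots> \<le> real (card I) * b" by (rule sum_bounded_above) (rule assms(2))
  also have "\<dots> \<le> k * b" using assms(3,4) by (rule mult_right_mono)
  finally show ?thesis .
qed

lemma card_pairs_le: "finite A \<Longrightarrow> finite B \<Longrightarrow> S \<subseteq> A \<times> B \<Longrightarrow> card S \<le> card A * card B"
  by (metis card_cartesian_product card_mono finite_cartesian_product)

subsection \<open>Three and seven colours\<close>

text \<open>A union bound over at most \<open>n^2\<close> ordered pairs, split at \<delta> n / 20
  common neighbours. With \<open>r = 3\<close> the constants are 180 = 20 * 9, 540 = 60 * 9, 4860 =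
  60 * 81 and 13/270 = (13/10) / 27.\<close>

lemma prob_rainbow_connected_three:
  assumes H: "E \<in> dense_graphs n \<delta>" and m: "m \<le> card (non_edges n E)"
    and d: "0 < \<delta>" "1 \<le> \<delta> * real n / 20"
  shows "1 - real n ^ 2 * (exp (- (\<delta> * real n / 180)) + (exp (- (\<delta> * real n / 540))
      + real n * exp (- (\<delta> * real n / 4860)) + exp (- (13 / 270 * \<delta>\<^sup>2 * real m))))
    \<le> measure_pmf.prob (random_coloured_graph n E m 3) {G. rainbow_connected n G}"
proof -
  have n: "n \<ge> 1" using d(2) by (cases n) auto
  have E: "E \<subseteq> nsets {1..n} 2" and deg: "\<And>v. v \<in> {1..n} \<Longrightarrow> \<delta> * real n \<le> real (card (nbrs E v))"
    using H dense_graphs_iff[OF n] by auto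
  define P where "P = {(u, v). u \<in> {1..n} \<and> v \<in> {1..n} \<and> u \<noteq> v}"
  let ?F = "\<lambda>(u, v). {(R, c). \<not> reach (E \<union> R) c {1, 2, 3} u v}"
  let ?b = "exp (- (\<delta> * real n / 180)) + (exp (- (\<delta> * real n / 540))
      + real n * exp (- (\<delta> * real n / 4860)) + exp (- (13 / 270 * \<delta>\<^sup>2 * real m)))"
  have sub: "P \<subseteq> {1..n} \<times> {1..n}" unfolding P_def by blast
  then have fin: "finite P" by (rule finite_subset) simp
  have "real (card P) \<le> real (card {1..n} * card {1..n})"
    by (rule of_nat_mono) (rule card_pairs_le[OF _ _ sub], simp_all)
  then have cardP: "real (card P) \<le> real n ^ 2" by (simp add: power2_eq_square)
  show ?thesis
  proof (rule prob_rainbow_connected_ge[OF E m, where F="\<Union>p\<in>P. ?F p"])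
    fix R c assume R: "R \<subseteq> non_edges n E" and nF: "(R, c) \<notin> (\<Union>p\<in>P. ?F p)"
    have ER: "E \<union> R \<subseteq> nsets {1..n} 2" using E R unfolding non_edges_def by blast
    have re: "reach (E \<union> R) c {1, 2, 3} u v" if "u \<in> {1..n}" "v \<in> {1..n}" for u v
      using nF that reach_refl unfolding P_def by (cases "u = v") auto
    show "rainbow_connected n (E \<union> R, c)"
      unfolding rainbow_connected_def prod.case
    proof (intro ballI)
      fix u v assume uv: "u \<in> {1..n}" "v \<in> {1..n}"
      show "\<exists>p. is_path n (E \<union> R) u p v \<and> rainbow c p"
        by (rule reach_imp_path[OF re[OF uv] ER uv(1)])
    qed
  next
    show "measure_pmf.prob (graph_pmf n E m 3) (\<Union>p\<in>P. ?F p) \<le> real n ^ 2 * ?b"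
    proof (rule prob_UN_le[OF fin])
      show "real (card P) \<le> real n ^ 2" by (rule cardP)
      fix p assume "p \<in> P"
      then obtain u v where p: "p = (u, v)" and uv: "u \<in> {1..n}" "v \<in> {1..n}" "u \<noteq> v" unfolding P_def by blast
      show "measure_pmf.prob (graph_pmf n E m 3) (?F p) \<le> ?b"
      proof (cases "\<delta> * real n / 20 \<le> real (card (nbrs E u \<inter> nbrs E v))")
        case True
        have "measure_pmf.prob (graph_pmf n E m 3) (?F p) \<le>
            measure_pmf.prob (graph_pmf n E m 3) {(R, c). \<not> reach (E \<union> R) c {1, 2} u v}"
        proof (rule measure_pmf.finite_measure_mono)
          have "reach E' c {1, 2} u v \<Longrightarrow> reach E' c {1, 2, 3} u v" for E' c
            unfolding reach_def by blast
          then show "?F p \<subseteq> {(R, c). \<not> reach (E \<union> R) c {1, 2} u v}" using p by auto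
        qed simp
        also have "\<dots> \<le> exp (- (\<delta> * real n / 20 / real 3 ^ 2))"
          by (rule prob_not_reach_two[OF E uv _ _ _ True]) auto
        finally show ?thesis by (simp add: add_increasing2)
      next
        case False
        then have "measure_pmf.prob (graph_pmf n E m 3) (?F p) \<le>
          exp (- (\<delta> * real n / (60 * real 3 ^ 2))) + real n * exp (- (\<delta> * real n / (60 * real 3 ^ 4)))
            + exp (- (13 / 10 * \<delta>\<^sup>2 * real m / real 3 ^ 3))"
          unfolding p prod.case
          by (intro prob_not_reach_three[OF E m uv _ d deg[OF uv(1)] deg[OF uv(2)]]) auto
        then show ?thesis by (simp add: add_increasing)
      qed
    qed auto
  qed
qed

text \<open>Only walks inside the net depend on \<open>R\<close>, so the term in \<open>m\<close>
  carries the constant factor (2 / \<delta>)^2 instead of \<open>n^2\<close>; hence \<open>m\<close>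
  tending to infinity will do. With \<open>r = 7\<close> the constants are 1960 = 40 * 49, 2940 = 60
  * 49, 144060 = 60 * 7^4 and 13/3430 = (13/10) / 343.\<close>

lemma prob_rainbow_connected_seven:
  assumes H: "E \<in> dense_graphs n \<delta>" and m: "m \<le> card (non_edges n E)"
    and d: "0 < \<delta>" "1 \<le> \<delta> * real n / 20"
  shows "1 - (real n ^ 2 * (2 * exp (- (\<delta>\<^sup>2 * real n / 1960))) + (2 / \<delta>) ^ 2 * (exp (- (\<delta> * real n / 2940))
      + real n * exp (- (\<delta> * real n / 144060)) + exp (- (13 / 3430 * \<delta>\<^sup>2 * real m))))
    \<le> measure_pmf.prob (random_coloured_graph n E m 7) {G. rainbow_connected n G}"
proof -
  have n: "n \<ge> 1" using d(2) by (cases n) auto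
  have E: "E \<subseteq> nsets {1..n} 2" and deg: "\<And>v. v \<in> {1..n} \<Longrightarrow> \<delta> * real n \<le> real (card (nbrs E v))"
    using H dense_graphs_iff[OF n] by auto
  have "\<exists>X\<subseteq>{1..n}. real (card X) \<le> 2 / \<delta> \<and>
    (\<forall>x\<in>X. \<forall>y\<in>X. x \<noteq> y \<longrightarrow> real (card (nbrs E x \<inter> nbrs E y)) \<le> \<delta> * real n / 20) \<and>
    (\<forall>v\<in>{1..n} - X. \<exists>x\<in>X. \<delta>\<^sup>2 * real n / 40 \<le> real (card (nbrs E v \<inter> nbrs E x)))"
    by (rule exists_net[OF E n d(1)]) (rule deg)
  then obtain X where X: "X \<subseteq> {1..n}" "real (card X) \<le> 2 / \<delta>"
    and sep: "\<forall>x\<in>X. \<forall>y\<in>X. x \<noteq> y \<longrightarrow> real (card (nbrs E x \<inter> nbrs E y)) \<le> \<delta> * real n / 20"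
    and cov: "\<forall>v\<in>{1..n} - X. \<exists>x\<in>X. \<delta>\<^sup>2 * real n / 40 \<le> real (card (nbrs E v \<inter> nbrs E x))"
    by (elim exE conjE) (rule that)
  have finX: "finite X" using X(1) by (rule finite_subset) simp
  let ?M = "graph_pmf n E m 7"
  define P where "P = {(v, x). v \<in> {1..n} \<and> x \<in> X \<and> v \<noteq> x \<and> \<delta>\<^sup>2 * real n / 40 \<le> real (card (nbrs E v \<inter> nbrs E x))}"
  define Q where "Q = {(x, y). x \<in> X \<and> y \<in> X \<and> x \<noteq> y}"
  let ?F = "\<lambda>(v, x). {(R, c). \<not> reach (E \<union> R) c {4, 5} v x} \<union> {(R, c). \<not> reach (E \<union> R) c {6, 7} x v}"
  let ?G = "\<lambda>(x, y). {(R, c). \<not> reach (E \<union> R) c {1, 2, 3} x y}"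
  let ?b = "exp (- (\<delta> * real n / 2940)) + real n * exp (- (\<delta> * real n / 144060)) + exp (- (13 / 3430 * \<delta>\<^sup>2 * real m))"
  have subP: "P \<subseteq> {1..n} \<times> {1..n}" using X(1) unfolding P_def by blast
  have subQ: "Q \<subseteq> X \<times> X" unfolding Q_def by blast
  have fin: "finite P" "finite Q"
    by (rule finite_subset[OF subP], simp) (rule finite_subset[OF subQ], simp add: finX)
  have "real (card P) \<le> real (card {1..n} * card {1..n})"
    by (rule of_nat_mono) (rule card_pairs_le[OF _ _ subP], simp_all)
  then have cardP: "real (card P) \<le> real n ^ 2" by (simp add: power2_eq_square)
  have "real (card Q) \<le> real (card X * card X)"
    by (rule of_nat_mono) (rule card_pairs_le[OF finX finX subQ])
  also have "\<dots> = real (card X) ^ 2" by (simp add: power2_eq_square)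
  also have "\<dots> \<le> (2 / \<delta>) ^ 2" using X(2) by (intro power_mono) auto
  finally have cardQ: "real (card Q) \<le> (2 / \<delta>) ^ 2" .
  show ?thesis
  proof (rule prob_rainbow_connected_ge[OF E m, where F="(\<Union>p\<in>P. ?F p) \<union> (\<Union>p\<in>Q. ?G p)"])
    fix R c assume R: "R \<subseteq> non_edges n E" and nF: "(R, c) \<notin> (\<Union>p\<in>P. ?F p) \<union> (\<Union>p\<in>Q. ?G p)"
    have ER: "E \<union> R \<subseteq> nsets {1..n} 2" using E R unfolding non_edges_def by blast
    \<comment> \<open>A member of the net enters and leaves it at itself, by the trivial
      walk.\<close>
    have net: "\<exists>x\<in>X. reach (E \<union> R) c {4, 5} v x \<and> reach (E \<union> R) c {6, 7} x v" if v: "v \<in> {1..n}" for v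
    proof (cases "v \<in> X")
      case True
      then show ?thesis using reach_refl by blast
    next
      case False
      then have "v \<in> {1..n} - X" using v by blast
      from bspec[OF cov this]
      obtain x where x: "x \<in> X" "\<delta>\<^sup>2 * real n / 40 \<le> real (card (nbrs E v \<inter> nbrs E x))"
        by blast
      then have "(v, x) \<in> P" unfolding P_def using v False by auto
      then have "(R, c) \<notin> ?F (v, x)" using nF by blast
      then show ?thesis using x by auto
    qed
    have mid: "reach (E \<union> R) c {1, 2, 3} x y" if "x \<in> X" "y \<in> X" for x y
      using nF that reach_refl unfolding Q_def by (cases "x = y") auto
    \<comment> \<open>The three pieces may share vertices, but their colour sets are disjoint, which
      is all that joining walks requires.\<close>
    have re: "reach (E \<union> R) c (({4, 5} \<union> {1, 2, 3}) \<union> {6, 7}) u v" if uv: "u \<in> {1..n}" "v \<in> {1..n}" for u v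
    proof -
      obtain x y where "x \<in> X" "y \<in> X" "reach (E \<union> R) c {4, 5} u x" "reach (E \<union> R) c {6, 7} y v"
        using net[OF uv(1)] net[OF uv(2)] by blast
      then show ?thesis using mid by (intro reach_trans[OF reach_trans]) auto
    qed
    show "rainbow_connected n (E \<union> R, c)"
      unfolding rainbow_connected_def prod.case
    proof (intro ballI)
      fix u v assume uv: "u \<in> {1..n}" "v \<in> {1..n}"
      show "\<exists>p. is_path n (E \<union> R) u p v \<and> rainbow c p"
        by (rule reach_imp_path[OF re[OF uv] ER uv(1)])
    qed
  next
    have "measure_pmf.prob ?M (\<Union>p\<in>P. ?F p) \<le> real n ^ 2 * (2 * exp (- (\<delta>\<^sup>2 * real n / 1960)))"
    proof (rule prob_UN_le[OF fin(1)])
      show "real (card P) \<le> real n ^ 2" by (rule cardP)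
      fix p assume "p \<in> P"
      then obtain v x where p: "p = (v, x)" and vx: "v \<in> {1..n}" "x \<in> {1..n}" "v \<noteq> x"
        and D: "\<delta>\<^sup>2 * real n / 40 \<le> real (card (nbrs E v \<inter> nbrs E x))"
        using X(1) unfolding P_def by blast
      have "measure_pmf.prob ?M {(R, c). \<not> reach (E \<union> R) c {4, 5} v x} \<le> exp (- (\<delta>\<^sup>2 * real n / 40 / real 7 ^ 2))"
        by (rule prob_not_reach_two[OF E vx _ _ _ D]) auto
      moreover have "measure_pmf.prob ?M {(R, c). \<not> reach (E \<union> R) c {6, 7} x v} \<le> exp (- (\<delta>\<^sup>2 * real n / 40 / real 7 ^ 2))"
        by (rule prob_not_reach_two[OF E vx(2,1)]) (use vx D in \<open>auto simp: Int_commute\<close>)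
      moreover have "measure_pmf.prob ?M (?F p) \<le> measure_pmf.prob ?M {(R, c). \<not> reach (E \<union> R) c {4, 5} v x}
          + measure_pmf.prob ?M {(R, c). \<not> reach (E \<union> R) c {6, 7} x v}"
        unfolding p prod.case by (rule measure_Un_le) auto
      ultimately show "measure_pmf.prob ?M (?F p) \<le> 2 * exp (- (\<delta>\<^sup>2 * real n / 1960))" by simp
    qed auto
    moreover have "measure_pmf.prob ?M (\<Union>p\<in>Q. ?G p) \<le> (2 / \<delta>) ^ 2 * ?b"
    proof (rule prob_UN_le[OF fin(2) _ cardQ])
      fix p assume "p \<in> Q"
      then obtain x y where p: "p = (x, y)" and xy: "x \<in> X" "y \<in> X" "x \<noteq> y" unfolding Q_def by blast
      then have few: "real (card (nbrs E x \<inter> nbrs E y)) \<le> \<delta> * real n / 20"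
        using bspec[OF bspec[OF sep xy(1)] xy(2)] by blast
      have V: "x \<in> {1..n}" "y \<in> {1..n}" using xy X(1) by blast+
      have "measure_pmf.prob ?M (?G p) \<le>
          exp (- (\<delta> * real n / (60 * real 7 ^ 2))) + real n * exp (- (\<delta> * real n / (60 * real 7 ^ 4)))
            + exp (- (13 / 10 * \<delta>\<^sup>2 * real m / real 7 ^ 3))"
        unfolding p prod.case
        by (rule prob_not_reach_three[OF E m V xy(3) _ d deg[OF V(1)] deg[OF V(2)] few]) simp
      then show "measure_pmf.prob ?M (?G p) \<le> ?b" by simp
    qed auto
    ultimately show "measure_pmf.prob ?M ((\<Union>p\<in>P. ?F p) \<union> (\<Union>p\<in>Q. ?G p)) \<le>
        real n ^ 2 * (2 * exp (- (\<delta>\<^sup>2 * real n / 1960))) + (2 / \<delta>) ^ 2 * ?b"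
      by (intro order_trans[OF measure_Un_le] add_mono) auto
  qed
qed

text \<open>The constant 60 enters through \<open>60 \<cdot> 13 / 270 = 26 / 9 > 2\<close>, which beats the \<open>n\<^sup>2\<close> pairs.\<close>

theorem whp_rainbow_connected_three:
  assumes d: "0 < \<delta>"
    and H: "\<forall>\<^sub>F n in sequentially. H n \<in> dense_graphs n \<delta> \<and> m n \<le> card (non_edges n (H n))"
    and m: "\<forall>\<^sub>F n in sequentially. real (m n) \<ge> 60 / \<delta>\<^sup>2 * ln (real n)"
  shows "whp (\<lambda>n. random_coloured_graph n (H n) (m n) 3) (\<lambda>n G. rainbow_connected n G)"
proof (rule whpI)
  have large: "\<forall>\<^sub>F n in sequentially. 1 \<le> \<delta> * real n / 20" using d by real_asymp
  show "\<forall>\<^sub>F n in sequentially. 1 - real n ^ 2 * (exp (- (\<delta> * real n / 180)) + (exp (- (\<delta> * real n / 540))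
      + real n * exp (- (\<delta> * real n / 4860)) + exp (- (26 / 9 * ln (real n)))))
    \<le> measure_pmf.prob (random_coloured_graph n (H n) (m n) 3) {G. rainbow_connected n G}"
    using H m large
  proof eventually_elim
    case (elim n)
    have "60 * ln (real n) / \<delta>\<^sup>2 \<le> real (m n)" using elim(2) by simp
    then have "60 * ln (real n) \<le> real (m n) * \<delta>\<^sup>2" by (rule pos_divide_le_eq[THEN iffD1, rotated]) (use d in simp)
    then have "60 * ln (real n) \<le> \<delta>\<^sup>2 * real (m n)" by (simp only: mult.commute[of "real (m n)"])
    then have "26 / 9 * ln (real n) \<le> 13 / 270 * (\<delta>\<^sup>2 * real (m n))" by linarith
    then have "exp (- (13 / 270 * \<delta>\<^sup>2 * real (m n))) \<le> exp (- (26 / 9 * ln (real n)))"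
      by (simp add: mult.assoc)
    then have "real n ^ 2 * (exp (- (\<delta> * real n / 180)) + (exp (- (\<delta> * real n / 540))
      + real n * exp (- (\<delta> * real n / 4860)) + exp (- (13 / 270 * \<delta>\<^sup>2 * real (m n)))))
      \<le> real n ^ 2 * (exp (- (\<delta> * real n / 180)) + (exp (- (\<delta> * real n / 540))
      + real n * exp (- (\<delta> * real n / 4860)) + exp (- (26 / 9 * ln (real n)))))"
      by (intro mult_left_mono add_left_mono) auto
    then show ?case
      using prob_rainbow_connected_three[OF conjunct1[OF elim(1)] conjunct2[OF elim(1)] d elim(3)]
      by linarith
  qed
  show "(\<lambda>n. real n ^ 2 * (exp (- (\<delta> * real n / 180)) + (exp (- (\<delta> * real n / 540))
      + real n * exp (- (\<delta> * real n / 4860)) + exp (- (26 / 9 * ln (real n)))))) \<longlonglongrightarrow> 0"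
    using d by real_asymp
qed

theorem whp_rainbow_connected_seven:
  assumes d: "0 < \<delta>"
    and H: "\<forall>\<^sub>F n in sequentially. H n \<in> dense_graphs n \<delta> \<and> m n \<le> card (non_edges n (H n))"
    and m: "filterlim m at_top sequentially"
  shows "whp (\<lambda>n. random_coloured_graph n (H n) (m n) 7) (\<lambda>n G. rainbow_connected n G)"
proof (rule whpI)
  have large: "\<forall>\<^sub>F n in sequentially. 1 \<le> \<delta> * real n / 20" using d by real_asymp
  \<comment> \<open>The error splits into a function of \<open>n\<close> and a function of
    \<open>m n\<close>; the latter vanishes by composing a limit in \<open>k\<close> with the
    divergence of \<open>m\<close>.\<close>
  let ?f = "\<lambda>n. real n ^ 2 * (2 * exp (- (\<delta>\<^sup>2 * real n / 1960)))
      + (2 / \<delta>) ^ 2 * (exp (- (\<delta> * real n / 2940)) + real n * exp (- (\<delta> * real n / 144060)))"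
  let ?g = "\<lambda>k::nat. (2 / \<delta>) ^ 2 * exp (- (13 / 3430 * \<delta>\<^sup>2 * real k))"
  show "\<forall>\<^sub>F n in sequentially. 1 - (?f n + ?g (m n))
    \<le> measure_pmf.prob (random_coloured_graph n (H n) (m n) 7) {G. rainbow_connected n G}"
    using H large
  proof eventually_elim
    case (elim n)
    then show ?case
      using prob_rainbow_connected_seven[OF conjunct1[OF elim(1)] conjunct2[OF elim(1)] d elim(2)]
      by (simp add: algebra_simps)
  qed
  have "(\<lambda>n::nat. real n ^ 2 * (2 * exp (- (a * real n / 1960)))) \<longlonglongrightarrow> 0" if "0 < a" for a
    using that by real_asymp
  from this[of "\<delta>\<^sup>2"] have "(\<lambda>n::nat. real n ^ 2 * (2 * exp (- (\<delta>\<^sup>2 * real n / 1960)))) \<longlonglongrightarrow> 0"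
    using d by simp
  moreover have "(\<lambda>n::nat. exp (- (\<delta> * real n / 2940)) + real n * exp (- (\<delta> * real n / 144060))) \<longlonglongrightarrow> 0"
    using d by real_asymp
  ultimately have "?f \<longlonglongrightarrow> 0" by (rule tendsto_add_zero[OF _ tendsto_mult_right_zero])
  moreover have "(\<lambda>k::nat. b * exp (- (13 / 3430 * a * real k))) \<longlonglongrightarrow> 0" if "0 < a" for a b :: real
    using that by real_asymp
  from this[of "\<delta>\<^sup>2" "(2 / \<delta>) ^ 2"] have "?g \<longlonglongrightarrow> 0" using d by simp
  then have "(\<lambda>n. ?g (m n)) \<longlonglongrightarrow> 0" by (rule filterlim_compose[OF _ m])
  ultimately show "(\<lambda>n. ?f n + ?g (m n)) \<longlonglongrightarrow> 0" by (rule tendsto_add_zero)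
qed

subsection \<open>Two complete bipartite graphs and four colours\<close>

definition matching :: "nat set set \<Rightarrow> bool" where
  "matching R \<longleftrightarrow> (\<forall>e\<in>R. \<forall>e'\<in>R. e \<noteq> e' \<longrightarrow> e \<inter> e' = {})"

definition bip :: "nat set \<Rightarrow> nat set \<Rightarrow> nat set set" where
  "bip P Q = {{a, b} | a b. a \<in> P \<and> b \<in> Q}"

lemma in_bip: "{a, b} \<in> bip P Q \<longleftrightarrow> a \<in> P \<and> b \<in> Q \<or> b \<in> P \<and> a \<in> Q"
  unfolding bip_def by (auto simp: doubleton_eq_iff)

text \<open>Meant for \<open>P\<close> the side opposite to \<open>u\<close> in its component and
  \<open>B\<close> the other component: a walk \<open>u a b\<close> leaving the component at its
  second edge then repeats a colour.\<close>

definition blocked :: "nat set set \<Rightarrow> (nat set \<Rightarrow> nat) \<Rightarrow> nat set \<Rightarrow> nat set \<Rightarrow> nat \<Rightarrow> bool" where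
  "blocked R c P B u \<longleftrightarrow> u \<notin> \<Union>R \<and> (\<forall>a\<in>P. \<forall>b\<in>B. {a, b} \<in> R \<longrightarrow> c {u, a} = c {a, b})"

text \<open>All neighbours of \<open>u\<close> lie in \<open>P1\<close> and those of
  \<open>v\<close> in \<open>P2\<close>, which rules out one or two edges. With three edges the
  middle one crosses between the components; with four, the second or the third does. That crossing
  edge is in \<open>R\<close> and has the colour of the end edge next to it.\<close>

lemma blocked_imp_no_rainbow_path:
  assumes dis: "P1 \<inter> Q1 = {}" "P2 \<inter> Q2 = {}" "(P1 \<union> Q1) \<inter> (P2 \<union> Q2) = {}"
    and V: "{1..n} \<subseteq> P1 \<union> Q1 \<union> P2 \<union> Q2"
    and G: "G = bip P1 Q1 \<union> bip P2 Q2 \<union> R" and mat: "matching R"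
    and c: "\<And>e. e \<in> G \<Longrightarrow> c e \<in> {1..4}"
    and u: "u \<in> Q1" "blocked R c P1 (P2 \<union> Q2) u" and v: "v \<in> Q2" "blocked R c P2 (P1 \<union> Q1) v"
    and p: "is_path n G u p v" "rainbow c p"
  shows False
proof -
  have first: "a \<in> P1" if "{u, a} \<in> G" for a
  proof -
    have "{u, a} \<notin> R" using u(2) unfolding blocked_def by blast
    then show ?thesis using that u(1) dis unfolding G by (auto simp: in_bip)
  qed
  have last: "a \<in> P2" if "{a, v} \<in> G" for a
  proof -
    have "{a, v} \<notin> R" using v(2) unfolding blocked_def by blast
    then show ?thesis using that v(1) dis unfolding G by (auto simp: in_bip)
  qed
  have cross: "{a, b} \<in> R" if "{a, b} \<in> G" "a \<in> P1 \<union> Q1" "b \<in> P2 \<union> Q2" for a b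
    using that dis unfolding G by (auto simp: in_bip)
  have bu: "c {u, a} = c {a, b}" if "a \<in> P1" "b \<in> P2 \<union> Q2" "{a, b} \<in> R" for a b
    using u(2) that unfolding blocked_def by blast
  have bv: "c {a, v} = c {b, a}" if "a \<in> P2" "b \<in> P1 \<union> Q1" "{b, a} \<in> R" for a b
    using v(2) that unfolding blocked_def by (metis insert_commute)
  have P: "p \<noteq> []" "hd p = u" "last p = v" "set p \<subseteq> {1..n}" "set (path_edges p) \<subseteq> G" "distinct p"
    using p(1) unfolding is_path_def by blast+
  have uv: "u \<noteq> v" using u(1) v(1) dis by blast
  \<comment> \<open>A rainbow path has as many colours as edges, so at most four edges and five
    vertices.\<close>
  have "length (path_edges p) = card (c ` set (path_edges p))"
    using p(2) unfolding rainbow_def by (metis distinct_card length_map set_map)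
  also have "\<dots> \<le> card {1..4::nat}" using P(5) c by (intro card_mono) auto
  finally have "length p \<le> 5" unfolding length_path_edges by simp
  obtain ys where ys: "p = u # ys" using P(1,2) by (cases p) auto
  have "ys \<noteq> []" using P(3) uv ys by auto
  then have "length ys \<in> {1, 2, 3, 4}" using \<open>length p \<le> 5\<close> ys by (cases "length ys") auto
  then consider (1) x where "p = [u, x]" | (2) a x where "p = [u, a, x]"
    | (3) a b x where "p = [u, a, b, x]" | (4) a b d x where "p = [u, a, b, d, x]"
    unfolding ys by (auto simp: length_Suc_conv numeral_eq_Suc)
  then show False
  proof cases
    case 1
    then have "p = [u, v]" using P(3) by simp
    then show False using P(5) first v(1) dis by auto
  next
    case 2
    then have "p = [u, a, v]" using P(3) by simp
    then show False using P(5) first[of a] last[of a] dis by auto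
  next
    case 3
    then have q: "p = [u, a, b, v]" using P(3) by simp
    then have e: "{u, a} \<in> G" "{a, b} \<in> G" "{b, v} \<in> G" using P(5) by auto
    then have ab: "a \<in> P1" "b \<in> P2" using first last by blast+
    then have "{a, b} \<in> R" using cross e(2) by blast
    then have "c {u, a} = c {a, b}" using bu ab by blast
    then show False using p(2) q unfolding rainbow_def by simp
  next
    case 4
    then have q: "p = [u, a, b, d, v]" using P(3) by simp
    then have e: "{u, a} \<in> G" "{a, b} \<in> G" "{b, d} \<in> G" "{d, v} \<in> G" using P(5) by auto
    then have ad: "a \<in> P1" "d \<in> P2" using first last by blast+
    have col: "c {u, a} \<noteq> c {a, b}" "c {d, v} \<noteq> c {b, d}"
      using p(2) q unfolding rainbow_def by auto
    have "b \<in> P1 \<union> Q1 \<union> P2 \<union> Q2" using P(4) q V by auto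
    then show False
    proof (cases "b \<in> P2 \<union> Q2")
      case True
      then show False using cross[OF e(2)] bu[OF ad(1) True] ad col by blast
    next
      case False
      then have "b \<in> P1 \<union> Q1" using \<open>b \<in> P1 \<union> Q1 \<union> P2 \<union> Q2\<close> by blast
      then show False using cross[OF e(3)] bv[OF ad(2)] ad col by blast
    qed
  qed
qed

section \<open>Existence of blocked vertices\<close>

lemma colouring_range:
  assumes "finite W" "c \<in> set_pmf (colouring W r)" "x \<in> W" "r \<ge> 1"
  shows "c x \<in> {1..r}"
  using assms set_Pi_pmf[OF assms(1), of 0 "\<lambda>_. pmf_of_set {1..r}"]
  unfolding colouring_def by (auto simp: PiE_dflt_def)

text \<open>Fix the colours on \<open>R\<close>. For \<open>u\<close> in \<open>Q\<close> untouched
  by \<open>R\<close>, being blocked prescribes the colours of at most \<open>m\<close> pairs at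
  \<open>u\<close>, and these sets of pairs are disjoint for distinct \<open>u\<close>. Since
  \<open>R\<close> touches at most \<open>2 m\<close> vertices, at least \<open>card Q - 2 m\<close>
  independent trials remain.\<close>

lemma prob_no_blocked:
  assumes R: "R \<subseteq> nsets {1..n} 2" "matching R" "card R = m"
    and V: "P \<subseteq> {1..n}" "Q \<subseteq> {1..n}" and dis: "P \<inter> Q = {}" "P \<inter> B = {}" and r: "r \<ge> 1"
  shows "measure_pmf.prob (colouring (nsets {1..n} 2) r) {c. \<not> (\<exists>u\<in>Q. blocked R c P B u)}
    \<le> exp (- ((real (card Q) - 2 * real m) / real r ^ m))"
proof -
  let ?W = "nsets {1..n} (2::nat)"
  define q where "q = exp (- ((real (card Q) - 2 * real m) / real r ^ m))"
  define Z where "Z = {(f, g). \<not> (\<exists>u\<in>Q. blocked R (\<lambda>x. if x \<in> ?W - R then f x else g x) P B u)}"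
  have W: "finite ?W" by (simp add: finite_imp_finite_nsets)
  have finR: "finite R" using R(1) W by (rule finite_subset)
  have finQ: "finite Q" using V(2) by (rule finite_subset) simp
  define I where "I = Q - \<Union>R"
  define D where "D = {a \<in> P. \<exists>b\<in>B. {a, b} \<in> R}"
  \<comment> \<open>The edge of \<open>R\<close> at \<open>a\<close>, unique because
    \<open>R\<close> is a matching.\<close>
  define \<phi> where "\<phi> a = (THE e. e \<in> R \<and> a \<in> e)" for a
  have \<phi>: "\<phi> a = e" if "e \<in> R" "a \<in> e" for a e
    unfolding \<phi>_def by (rule the_equality) (use that R(2) in \<open>auto simp: matching_def\<close>)
  have cardD: "card D \<le> m"
  proof -
    \<comment> \<open>An edge from \<open>P\<close> to \<open>B\<close> has only one end in
      \<open>P\<close>, as these sets are disjoint; so distinct elements of \<open>D\<close> have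
      distinct edges.\<close>
    have "inj_on \<phi> D"
    proof (rule inj_onI)
      fix a a' assume a: "a \<in> D" "a' \<in> D" "\<phi> a = \<phi> a'"
      then obtain b b' where b: "b \<in> B" "b' \<in> B" "{a, b} \<in> R" "{a', b'} \<in> R"
        unfolding D_def by blast
      then have "{a, b} = {a', b'}" using a(3) \<phi>[of "{a, b}" a] \<phi>[of "{a', b'}" a'] by simp
      then show "a = a'" using a b dis(2) unfolding D_def by (auto simp: doubleton_eq_iff)
    qed
    moreover have "\<phi> ` D \<subseteq> R"
    proof
      fix e assume "e \<in> \<phi> ` D"
      then obtain a b where "e = \<phi> a" "{a, b} \<in> R" unfolding D_def by blast
      then show "e \<in> R" using \<phi>[of "{a, b}" a] by simp
    qed
    ultimately show ?thesis using card_inj_on_le[OF _ _ finR] R(3) by blast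
  qed
  have cardI: "real (card Q) - 2 * real m \<le> real (card I)"
  proof -
    have "card (\<Union>R) \<le> (\<Sum>e\<in>R. card e)" by (rule card_Union_le_sum_card)
    also have "\<dots> = (\<Sum>e\<in>R. 2)" by (rule sum.cong) (use R(1) in \<open>auto simp: nsets_def\<close>)
    finally have "card (\<Union>R) \<le> 2 * m" using R(3) by simp
    moreover have "finite (\<Union>R)" using finR R(1) by (auto simp: nsets_def)
    then have "card Q - card (\<Union>R) \<le> card I" unfolding I_def by (intro diff_card_le_card_Diff)
    ultimately show ?thesis by linarith
  qed
  have "colouring ((?W - R) \<union> R) r = map_pmf (\<lambda>(f, g) x. if x \<in> ?W - R then f x else g x)
      (pair_pmf (colouring (?W - R) r) (colouring R r))"
    unfolding colouring_def by (rule Pi_pmf_union) (use W finR in auto)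
  moreover have "(?W - R) \<union> R = ?W" using R(1) by blast
  ultimately have "colouring ?W r = map_pmf (\<lambda>(f, g) x. if x \<in> ?W - R then f x else g x)
      (pair_pmf (colouring (?W - R) r) (colouring R r))" by simp
  then have "measure_pmf.prob (colouring ?W r) {c. \<not> (\<exists>u\<in>Q. blocked R c P B u)} =
      measure_pmf.prob (pair_pmf (colouring (?W - R) r) (colouring R r)) Z"
    unfolding Z_def by (simp add: vimage_def case_prod_unfold)
  \<comment> \<open>The exceptional set is empty: the estimate holds for every possible colouring
    \<open>g\<close> of \<open>R\<close>.\<close>
  also have "\<dots> \<le> measure_pmf.prob (colouring R r) {} + q"
  proof (rule prob_pair_pmf_le)
    fix g assume g: "g \<in> set_pmf (colouring R r)"
    define K where "K u = (\<lambda>a. {u, a}) ` D" for u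
    \<comment> \<open>For \<open>x = {u, a}\<close> this recovers \<open>a\<close> and prescribes
      the colour of the edge of \<open>R\<close> at \<open>a\<close>.\<close>
    define t where "t u x = g (\<phi> (the_elem (x - {u})))" for u :: nat and x
    have t: "t u {u, a} = g e" if "u \<in> I" "a \<in> D" "e \<in> R" "a \<in> e" for u a e
    proof -
      have "u \<noteq> a" using that dis(1) unfolding I_def D_def by blast
      then have "{u, a} - {u} = {a}" by blast
      then show ?thesis unfolding t_def using \<phi>[OF that(3,4)] by simp
    qed
    have "{f. (f, g) \<in> Z} \<subseteq> {f. \<forall>u\<in>I. \<not> (\<forall>x\<in>K u. f x = t u x)}"
    proof (rule subsetI, rule ccontr)
      fix f assume f: "f \<in> {f. (f, g) \<in> Z}" and "f \<notin> {f. \<forall>u\<in>I. \<not> (\<forall>x\<in>K u. f x = t u x)}"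
      then obtain u where u: "u \<in> I" "\<And>x. x \<in> K u \<Longrightarrow> f x = t u x" by blast
      let ?h = "\<lambda>x. if x \<in> ?W - R then f x else g x"
      have "blocked R ?h P B u" unfolding blocked_def
      proof (intro conjI ballI impI)
        show "u \<notin> \<Union>R" using u unfolding I_def by blast
        fix a b assume ab: "a \<in> P" "b \<in> B" "{a, b} \<in> R"
        then have aD: "a \<in> D" unfolding D_def by blast
        have "{u, a} \<notin> R" using u(1) unfolding I_def by blast
        moreover have "{u, a} \<in> ?W" using u(1) ab(1) V dis(1) unfolding I_def by auto
        ultimately have "?h {u, a} = f {u, a}" by simp
        also have "\<dots> = t u {u, a}" using u(2) aD unfolding K_def by blast
        also have "\<dots> = g {a, b}" by (rule t[OF u(1) aD ab(3)]) simp
        finally show "?h {u, a} = ?h {a, b}" using ab(3) by simp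
      qed
      then show False using f u(1) unfolding Z_def I_def by blast
    qed
    then have "measure_pmf.prob (colouring (?W - R) r) {f. (f, g) \<in> Z} \<le>
        measure_pmf.prob (colouring (?W - R) r) {f. \<forall>u\<in>I. \<not> (\<forall>x\<in>K u. f x = t u x)}"
      by (rule measure_pmf.finite_measure_mono) simp
    also have "\<dots> \<le> exp (- (real (card I) / real r ^ m))"
    proof (rule prob_no_pattern)
      show "finite (?W - R)" "finite I" using W finQ unfolding I_def by auto
      show "K u \<subseteq> ?W - R" if "u \<in> I" for u
      proof
        fix x assume "x \<in> K u"
        then obtain a where a: "a \<in> P" "x = {u, a}" unfolding K_def D_def by blast
        then have "x \<in> ?W" using that V dis(1) unfolding I_def by auto
        moreover have "x \<notin> R" using a that unfolding I_def by blast
        ultimately show "x \<in> ?W - R" by blast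
      qed
      show "disjoint_family_on K I"
        using dis(1) unfolding disjoint_family_on_def K_def I_def D_def by (auto simp: doubleton_eq_iff)
      show "t u x \<in> {1..r}" if ux: "u \<in> I" "x \<in> K u" for u x
      proof -
        obtain a where a: "a \<in> D" "x = {u, a}" using ux(2) unfolding K_def by blast
        then obtain b where ab: "a \<in> D" "x = {u, a}" "{a, b} \<in> R" unfolding D_def by blast
        then have "t u x = g {a, b}" using t[OF ux(1) ab(1) ab(3)] by simp
        then show ?thesis using colouring_range[OF finR g ab(3) r] by simp
      qed
      have finD: "finite D" using V(1) unfolding D_def by (auto intro: finite_subset)
      show "card (K u) \<le> m" for u
        unfolding K_def using card_image_le[OF finD] cardD by (rule order_trans)
    qed (use r in auto)
    also have "\<dots> \<le> q" unfolding q_def using cardI by (simp add: divide_right_mono)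
    finally show "measure_pmf.prob (colouring (?W - R) r) {f. (f, g) \<in> Z} \<le> q" .
  qed (simp add: q_def)
  finally show ?thesis unfolding q_def by simp
qed

text \<open>The mirror image, for fixing \<open>R\<close> first and then drawing the
  colouring.\<close>

lemma prob_pair_pmf_le':
  assumes "\<And>x. x \<in> set_pmf A \<Longrightarrow> x \<notin> X \<Longrightarrow> measure_pmf.prob B {y. (x, y) \<in> Z} \<le> q" and q: "0 \<le> q"
  shows "measure_pmf.prob (pair_pmf A B) Z \<le> measure_pmf.prob A X + q"
proof -
  have "measure_pmf.prob (pair_pmf A B) Z = measure_pmf.prob (pair_pmf B A) {(y, x). (x, y) \<in> Z}"
    by (subst pair_commute_pmf) (simp add: vimage_def case_prod_unfold)
  also have "\<dots> \<le> measure_pmf.prob A X + q"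
    by (rule prob_pair_pmf_le) (use assms in auto)
  finally show ?thesis .
qed

text \<open>Two distinct edges meeting in \<open>x\<close> have the form \<open>{x, y}\<close>,
  \<open>{x, z}\<close>; a union bound over at most \<open>n^3\<close> triples.\<close>

lemma prob_not_matching:
  assumes m: "m \<le> card (non_edges n E)"
  shows "measure_pmf.prob (pmf_of_set (nsets (non_edges n E) m)) {R. \<not> matching R}
    \<le> real n ^ 3 * (real m / real (card (non_edges n E)))\<^sup>2"
proof -
  let ?M = "pmf_of_set (nsets (non_edges n E) m)"
  define T where "T = {(x, y, z). x \<in> {1..n} \<and> y \<in> {1..n} \<and> z \<in> {1..n} \<and> y \<noteq> z \<and>
      {x, y} \<in> non_edges n E \<and> {x, z} \<in> non_edges n E}"
  let ?F = "\<lambda>(x, y, z). {R. {x, y} \<in> R \<and> {x, z} \<in> R}"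
  have sub: "T \<subseteq> {1..n} \<times> {1..n} \<times> {1..n}" unfolding T_def by blast
  have finT: "finite T" using sub by (rule finite_subset) simp
  have "card T \<le> card ({1..n} \<times> {1..n} \<times> {1..n})" using sub by (intro card_mono) auto
  also have "\<dots> = n ^ 3" by (simp add: power3_eq_cube)
  finally have "real (card T) \<le> real (n ^ 3)" by (rule of_nat_mono)
  then have cardT: "real (card T) \<le> real n ^ 3" by simp
  have "measure_pmf.prob ?M {R. \<not> matching R} \<le> measure_pmf.prob ?M (\<Union>t\<in>T. ?F t)"
  proof (rule measure_pmf.finite_measure_mono_AE)
    have "R \<in> (\<Union>t\<in>T. ?F t)" if R: "R \<subseteq> non_edges n E" "\<not> matching R" for R
    proof -
      obtain e e' x where e: "e \<in> R" "e' \<in> R" "e \<noteq> e'" "x \<in> e" "x \<in> e'"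
        using R(2) unfolding matching_def by blast
      then have N: "e \<in> nsets {1..n} 2" "e' \<in> nsets {1..n} 2"
        using R(1) unfolding non_edges_def by auto
      have "\<exists>y. y \<in> {1..n} \<and> f = {x, y}" if f: "f \<in> nsets {1..n} 2" "x \<in> f" for f
      proof -
        obtain a b where "f = {a, b}" "a \<in> {1..n}" "b \<in> {1..n}" "a \<noteq> b" using f(1) by (rule nsets2_E)
        then show ?thesis using f(2) by (cases "x = a") auto
      qed
      then obtain y z where yz: "y \<in> {1..n}" "z \<in> {1..n}" "e = {x, y}" "e' = {x, z}"
        using N e(4,5) by metis
      moreover have "x \<in> {1..n}" using N(1) e(4) unfolding nsets_def by blast
      ultimately have "(x, y, z) \<in> T" using e R(1) unfolding T_def by blast
      then show ?thesis using e(1,2) yz(3,4) by (intro UN_I[of "(x, y, z)"]) auto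
    qed
    then show "AE R in ?M. R \<in> {R. \<not> matching R} \<longrightarrow> R \<in> (\<Union>t\<in>T. ?F t)"
      unfolding AE_measure_pmf_iff set_pmf_nsets[OF m] by (simp add: nsets_def)
  qed simp
  also have "\<dots> \<le> real n ^ 3 * (real m / real (card (non_edges n E)))\<^sup>2"
  proof (rule prob_UN_le[OF finT _ cardT])
    fix t assume "t \<in> T"
    then obtain x y z where t: "t = (x, y, z)" "y \<noteq> z" "{x, y} \<in> non_edges n E" "{x, z} \<in> non_edges n E"
      unfolding T_def by blast
    have "{x, y} \<noteq> {x, z}" using t(2) by (auto simp: doubleton_eq_iff)
    then show "measure_pmf.prob ?M (?F t) \<le> (real m / real (card (non_edges n E)))\<^sup>2"
      unfolding t(1) prod.case using prob_nsets_two[OF finite_non_edges m t(3,4)] by blast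
  qed simp
  finally show ?thesis .
qed

section \<open>The graph for four colours\<close>

definition double_bip :: "nat \<Rightarrow> nat set set" where
  "double_bip n = (let k = n div 4 in
     bip {1..k} {k<..2 * k} \<union> bip {2 * k<..3 * k} {3 * k<..n})"

lemma nbrs_double_bip:
  assumes "k = n div 4"
  shows "v \<in> {1..k} \<Longrightarrow> nbrs (double_bip n) v = {k<..2 * k}"
    "v \<in> {k<..2 * k} \<Longrightarrow> nbrs (double_bip n) v = {1..k}"
    "v \<in> {2 * k<..3 * k} \<Longrightarrow> nbrs (double_bip n) v = {3 * k<..n}"
    "v \<in> {3 * k<..n} \<Longrightarrow> nbrs (double_bip n) v = {2 * k<..3 * k}"
  using assms unfolding nbrs_def double_bip_def Let_def Un_iff in_bip by auto

lemma div4_ge: "8 \<le> n \<Longrightarrow> real n / 8 \<le> real (n div 4)"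
  by linarith

text \<open>Three parts have size \<open>n div 4\<close> and the last one takes the remainder, so
  every degree is at least \<open>n div 4\<close>, which is at least n / 8 and hence n / 10.\<close>

lemma double_bip_dense:
  assumes n: "8 \<le> n" and d: "\<delta> \<le> 1 / 10"
  shows "double_bip n \<in> dense_graphs n \<delta>"
proof -
  define k where "k = n div 4"
  have k: "4 * k \<le> n" "real n / 8 \<le> real k" using div4_ge[OF n] unfolding k_def by auto
  have sub: "double_bip n \<subseteq> nsets {1..n} 2"
    using k(1) unfolding double_bip_def Let_def bip_def k_def[symmetric] by auto
  have "k \<le> card (nbrs (double_bip n) v)" if v: "v \<in> {1..n}" for v
  proof -
    consider "v \<in> {1..k}" | "v \<in> {k<..2 * k}" | "v \<in> {2 * k<..3 * k}" | "v \<in> {3 * k<..n}"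
      using v by fastforce
    then show ?thesis using nbrs_double_bip[OF k_def, of v] k(1) by cases auto
  qed
  then have "\<delta> * real n \<le> real (card (nbrs (double_bip n) v))" if "v \<in> {1..n}" for v
  proof -
    have "\<delta> * real n \<le> 1 / 10 * real n" using d by (rule mult_right_mono) simp
    also have "\<dots> \<le> real k" using k(2) by linarith
    also have "\<dots> \<le> real (card (nbrs (double_bip n) v))"
      using \<open>\<And>v. v \<in> {1..n} \<Longrightarrow> k \<le> card (nbrs (double_bip n) v)\<close> that by simp
    finally show ?thesis .
  qed
  then show ?thesis using dense_graphs_iff[of n "double_bip n" \<delta>] n sub by simp
qed

text \<open>It suffices to count the pairs between the first and the third part, which lie in
  different components.\<close>

lemma card_non_edges_double_bip:
  assumes n: "8 \<le> n"
  shows "(real n / 8)\<^sup>2 \<le> real (card (non_edges n (double_bip n)))"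
proof -
  define k where "k = n div 4"
  have k: "4 * k \<le> n" "real n / 8 \<le> real k" using div4_ge[OF n] unfolding k_def by auto
  let ?S = "(\<lambda>(a, b). {a, b}) ` ({1..k} \<times> {2 * k<..3 * k})"
  have inj: "inj_on (\<lambda>(a, b). {a, b}) ({1..k} \<times> {2 * k<..3 * k})"
    by (auto simp: inj_on_def doubleton_eq_iff)
  have "?S \<subseteq> non_edges n (double_bip n)"
    using k(1) unfolding non_edges_def double_bip_def Let_def k_def[symmetric] by (auto simp: in_bip)
  then have "card ?S \<le> card (non_edges n (double_bip n))" by (intro card_mono finite_non_edges)
  moreover have "card ?S = k\<^sup>2" using card_image[OF inj] by (simp add: power2_eq_square)
  ultimately have "real (k\<^sup>2) \<le> real (card (non_edges n (double_bip n)))" by simp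
  then have "(real k)\<^sup>2 \<le> real (card (non_edges n (double_bip n)))" by simp
  moreover have "(real n / 8)\<^sup>2 \<le> (real k)\<^sup>2" using k(2) by (intro power_mono) auto
  ultimately show ?thesis by (rule order_trans[rotated])
qed

text \<open>The first term bounds the failure of \<open>R\<close> to be a matching:
  \<open>n^3 (64 m / n^2)^2 = 4096 m^2 / n\<close>. For a matching, connectivity forces
  \<open>Q1\<close> or \<open>Q2\<close> to have no blocked vertex, whence the factor 2.\<close>

lemma prob_double_bip_rainbow_connected:
  assumes n: "8 \<le> n" and m: "m \<le> card (non_edges n (double_bip n))"
  shows "measure_pmf.prob (random_coloured_graph n (double_bip n) m 4) {G. rainbow_connected n G}
    \<le> 4096 * real m ^ 2 / real n + 2 * exp (- ((real n / 8 - 2 * real m) / 4 ^ m))"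
proof -
  define k where "k = n div 4"
  have k: "4 * k \<le> n" "real n / 8 \<le> real k" using div4_ge[OF n] unfolding k_def by auto
  define P1 Q1 P2 Q2 where "P1 = {1..k}" and "Q1 = {k<..2 * k}"
    and "P2 = {2 * k<..3 * k}" and "Q2 = {3 * k<..n}"
  note defs = P1_def Q1_def P2_def Q2_def
  have E: "double_bip n = bip P1 Q1 \<union> bip P2 Q2"
    unfolding double_bip_def Let_def defs k_def by simp
  have dis: "P1 \<inter> Q1 = {}" "P2 \<inter> Q2 = {}" "(P1 \<union> Q1) \<inter> (P2 \<union> Q2) = {}"
    "P1 \<inter> (P2 \<union> Q2) = {}" "P2 \<inter> (P1 \<union> Q1) = {}"
    unfolding defs by auto
  have V: "{1..n} \<subseteq> P1 \<union> Q1 \<union> P2 \<union> Q2" unfolding defs by auto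
  have sub: "P1 \<subseteq> {1..n}" "Q1 \<subseteq> {1..n}" "P2 \<subseteq> {1..n}" "Q2 \<subseteq> {1..n}"
    unfolding defs using k(1) by auto
  have cQ: "real n / 8 \<le> real (card Q1)" "real n / 8 \<le> real (card Q2)"
    unfolding defs using k by auto
  \<comment> \<open>Density with parameter 0 is used just for its inclusion part.\<close>
  have Esub: "double_bip n \<subseteq> nsets {1..n} 2"
    using double_bip_dense[OF n, of 0] unfolding dense_graphs_def by simp
  let ?W = "nsets {1..n} (2::nat)"
  let ?C = "colouring ?W 4"
  let ?N = "non_edges n (double_bip n)"
  let ?q = "exp (- ((real n / 8 - 2 * real m) / 4 ^ m))"
  have W: "finite ?W" by (simp add: finite_imp_finite_nsets)
  have "measure_pmf.prob (random_coloured_graph n (double_bip n) m 4) {G. rainbow_connected n G}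
      = measure_pmf.prob (pair_pmf (pmf_of_set (nsets ?N m)) ?C) {(R, c). rainbow_connected n (double_bip n \<union> R, c)}"
    by (rule prob_rainbow_connected[OF Esub m])
  also have "\<dots> \<le> measure_pmf.prob (pmf_of_set (nsets ?N m)) {R. \<not> matching R} + 2 * ?q"
  proof (rule prob_pair_pmf_le')
    fix R assume "R \<in> set_pmf (pmf_of_set (nsets ?N m))" and "R \<notin> {R. \<not> matching R}"
    then have "R \<in> nsets ?N m" and mat: "matching R" using set_pmf_nsets[OF m] by auto
    then have R: "R \<subseteq> ?N" "card R = m" "matching R" by (auto simp: nsets_def)
    then have RW: "R \<subseteq> ?W" unfolding non_edges_def by blast
    let ?S1 = "{c. \<not> (\<exists>u\<in>Q1. blocked R c P1 (P2 \<union> Q2) u)}"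
    let ?S2 = "{c. \<not> (\<exists>u\<in>Q2. blocked R c P2 (P1 \<union> Q1) u)}"
    have q: "exp (- ((real (card Q) - 2 * real m) / real 4 ^ m)) \<le> ?q" if "real n / 8 \<le> real (card Q)" for Q :: "nat set"
      using that by (simp add: divide_right_mono)
    have "measure_pmf.prob ?C {c. rainbow_connected n (double_bip n \<union> R, c)} \<le> measure_pmf.prob ?C (?S1 \<union> ?S2)"
    proof (rule measure_pmf.finite_measure_mono_AE)
      have "c \<in> ?S1 \<union> ?S2" if c: "c \<in> set_pmf ?C" and rc: "rainbow_connected n (double_bip n \<union> R, c)" for c
      proof (rule ccontr)
        assume "c \<notin> ?S1 \<union> ?S2"
        then obtain u v where u: "u \<in> Q1" "blocked R c P1 (P2 \<union> Q2) u"
          and v: "v \<in> Q2" "blocked R c P2 (P1 \<union> Q1) v" by blast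
        have "u \<in> {1..n}" "v \<in> {1..n}" using u(1) v(1) sub by blast+
        then obtain p where p: "is_path n (double_bip n \<union> R) u p v" "rainbow c p"
          using rc unfolding rainbow_connected_def by blast
        have col: "c e \<in> {1..4}" if "e \<in> double_bip n \<union> R" for e
          by (rule colouring_range[OF W c]) (use that Esub RW in auto)
        have G: "double_bip n \<union> R = bip P1 Q1 \<union> bip P2 Q2 \<union> R" using E by simp
        show False
          by (rule blocked_imp_no_rainbow_path[OF dis(1-3) V G R(3) col u v p])
      qed
      then show "AE c in ?C. c \<in> {c. rainbow_connected n (double_bip n \<union> R, c)} \<longrightarrow> c \<in> ?S1 \<union> ?S2"
        unfolding AE_measure_pmf_iff by blast
    qed simp
    also have "\<dots> \<le> measure_pmf.prob ?C ?S1 + measure_pmf.prob ?C ?S2"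
      by (rule measure_Un_le) auto
    also have "\<dots> \<le> ?q + ?q"
    proof (rule add_mono)
      show "measure_pmf.prob ?C ?S1 \<le> ?q"
        by (rule order_trans[OF prob_no_blocked[OF RW R(3,2) sub(1,2) dis(1,4)] q[OF cQ(1)]]) simp
      show "measure_pmf.prob ?C ?S2 \<le> ?q"
        by (rule order_trans[OF prob_no_blocked[OF RW R(3,2) sub(3,4) dis(2,5)] q[OF cQ(2)]]) simp
    qed
    finally show "measure_pmf.prob ?C {c. (R, c) \<in> {(R, c). rainbow_connected n (double_bip n \<union> R, c)}} \<le> 2 * ?q"
      by simp
  qed simp
  also have "measure_pmf.prob (pmf_of_set (nsets ?N m)) {R. \<not> matching R} \<le> real n ^ 3 * (real m / real (card ?N))\<^sup>2"
    by (rule prob_not_matching[OF m])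
  also have "\<dots> \<le> real n ^ 3 * (real m / (real n / 8)\<^sup>2)\<^sup>2"
    using n by (intro mult_left_mono power_mono divide_left_mono card_non_edges_double_bip mult_pos_pos
        less_le_trans[OF _ card_non_edges_double_bip[OF n]]) auto
  also have "\<dots> = 4096 * real m ^ 2 / real n"
    using n by (simp add: power2_eq_square power3_eq_cube field_simps)
  finally show ?thesis by simp
qed

text \<open>The bound \<open>ln 2 \<le> 25 / 36\<close> makes the exponent of \<open>n\<close> smaller than 1, as needed to beat the linear
  number of candidates for a blocked vertex.\<close>

lemma four_power_le:
  assumes "real m \<le> 1 / 2 * ln (real n)" "n \<ge> 1"
  shows "4 ^ m \<le> exp (25 / 36 * ln (real n))"
proof -
  have "ln (4::real) = 2 * ln 2" using ln_realpow[of 2 2] by simp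
  then have l: "ln (4::real) \<le> 25 / 18" using ln2_le_25_over_36 by simp
  have "real m * ln 4 \<le> (1 / 2 * ln (real n)) * (25 / 18)"
    using assms l by (intro mult_mono) auto
  then have "real m * ln 4 \<le> 25 / 36 * ln (real n)" by simp
  then have "exp (real m * ln 4) \<le> exp (25 / 36 * ln (real n))" by (simp only: exp_le_cancel_iff)
  then show ?thesis by (simp add: exp_of_nat_mult)
qed

text \<open>Here \<open>2 m\<close> is at most \<open>ln n\<close> and \<open>4 ^ m\<close> at most
  \<open>n\<close> to the power 25/36, so the exponent grows like \<open>n\<close> to the power
  11/36, while \<open>m^2 / n\<close> tends to 0.\<close>

theorem whp_double_bip_not_rainbow_connected:
  assumes m: "\<forall>\<^sub>F n in sequentially. real (m n) \<le> 1 / 2 * ln (real n)"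
  shows "(\<forall>\<^sub>F n in sequentially. m n \<le> card (non_edges n (double_bip n))) \<and>
    whp (\<lambda>n. random_coloured_graph n (double_bip n) (m n) 4) (\<lambda>n G. \<not> rainbow_connected n G)"
proof (intro conjI)
  have ev: "\<forall>\<^sub>F n::nat in sequentially. 1 / 2 * ln (real n) \<le> (real n / 8)\<^sup>2"
    "\<forall>\<^sub>F n::nat in sequentially. 0 \<le> real n / 8 - ln (real n)" by real_asymp+
  have n8: "\<forall>\<^sub>F n in sequentially. 8 \<le> (n::nat)" by (rule eventually_ge_at_top)
  show card: "\<forall>\<^sub>F n in sequentially. m n \<le> card (non_edges n (double_bip n))"
    using m ev(1) n8
  proof eventually_elim
    case (elim n)
    then have "real (m n) \<le> real (card (non_edges n (double_bip n)))"
      using card_non_edges_double_bip[of n] by linarith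
    then show ?case by simp
  qed
  show "whp (\<lambda>n. random_coloured_graph n (double_bip n) (m n) 4) (\<lambda>n G. \<not> rainbow_connected n G)"
  proof (rule whpI)
    show "\<forall>\<^sub>F n in sequentially. 1 - (4096 * (1 / 2 * ln (real n))\<^sup>2 / real n
          + 2 * exp (- ((real n / 8 - ln (real n)) / exp (25 / 36 * ln (real n)))))
        \<le> measure_pmf.prob (random_coloured_graph n (double_bip n) (m n) 4) {G. \<not> rainbow_connected n G}"
      using m card ev(2) n8
    proof eventually_elim
      case (elim n)
      let ?M = "random_coloured_graph n (double_bip n) (m n) 4"
      have "real (m n) ^ 2 \<le> (1 / 2 * ln (real n))\<^sup>2" using elim(1) by (intro power_mono) auto
      then have "4096 * real (m n) ^ 2 / real n \<le> 4096 * (1 / 2 * ln (real n))\<^sup>2 / real n"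
        by (intro divide_right_mono mult_left_mono) auto
      moreover have "(real n / 8 - ln (real n)) / exp (25 / 36 * ln (real n)) \<le> (real n / 8 - 2 * real (m n)) / 4 ^ m n"
        using elim four_power_le[OF elim(1)] by (intro frac_le) auto
      then have "exp (- ((real n / 8 - 2 * real (m n)) / 4 ^ m n)) \<le> exp (- ((real n / 8 - ln (real n)) / exp (25 / 36 * ln (real n))))"
        by simp
      moreover have "measure_pmf.prob ?M {G. \<not> rainbow_connected n G} = 1 - measure_pmf.prob ?M {G. rainbow_connected n G}"
        using measure_pmf.prob_compl[of "{G. rainbow_connected n G}" ?M]
        by (simp add: Compl_eq_Diff_UNIV[symmetric] Collect_neg_eq)
      ultimately show ?case
        using prob_double_bip_rainbow_connected[OF elim(4) elim(2)] by linarith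
    qed
    show "(\<lambda>n. 4096 * (1 / 2 * ln (real n))\<^sup>2 / real n
          + 2 * exp (- ((real n / 8 - ln (real n)) / exp (25 / 36 * ln (real n))))) \<longlonglongrightarrow> 0"
      by real_asymp
  qed
qed

text \<open>Asymptotic statements concern sequences \<open>H\<close> and \<open>m\<close>. In (i)
  and (iii) it is assumed that \<open>m n\<close> non-edges exist, so that the random graph is
  meaningful; in (ii) this is concluded, and one sequence \<open>H\<close> serves every
  \<open>m\<close>.\<close>

theorem theorem3:
  fixes \<delta> :: real
  assumes "0 < \<delta>" and "\<delta> < 1/2"
  shows
    "(\<forall>(H :: nat \<Rightarrow> nat set set) (m :: nat \<Rightarrow> nat).
        (\<forall>\<^sub>F n in sequentially. H n \<in> dense_graphs n \<delta> \<and> m n \<le> card (non_edges n (H n))) \<longrightarrow>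
        (\<forall>\<^sub>F n in sequentially. real (m n) \<ge> 60 / \<delta>\<^sup>2 * ln (real n)) \<longrightarrow>
        whp (\<lambda>n. random_coloured_graph n (H n) (m n) 3) (\<lambda>n G. rainbow_connected n G)) \<and>
     (\<delta> \<le> 1/10 \<longrightarrow>
      (\<exists>H :: nat \<Rightarrow> nat set set.
        (\<forall>\<^sub>F n in sequentially. H n \<in> dense_graphs n \<delta>) \<and>
        (\<forall>m :: nat \<Rightarrow> nat. (\<forall>\<^sub>F n in sequentially. real (m n) \<le> 1/2 * ln (real n)) \<longrightarrow>
          (\<forall>\<^sub>F n in sequentially. m n \<le> card (non_edges n (H n))) \<and>
          whp (\<lambda>n. random_coloured_graph n (H n) (m n) 4) (\<lambda>n G. \<not> rainbow_connected n G)))) \<and>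
     (\<forall>(H :: nat \<Rightarrow> nat set set) (m :: nat \<Rightarrow> nat).
        (\<forall>\<^sub>F n in sequentially. H n \<in> dense_graphs n \<delta> \<and> m n \<le> card (non_edges n (H n))) \<longrightarrow>
        filterlim m at_top sequentially \<longrightarrow>
        whp (\<lambda>n. random_coloured_graph n (H n) (m n) 7) (\<lambda>n G. rainbow_connected n G))"
proof (intro conjI allI impI)
  fix H :: "nat \<Rightarrow> nat set set" and m :: "nat \<Rightarrow> nat"
  assume "\<forall>\<^sub>F n in sequentially. H n \<in> dense_graphs n \<delta> \<and> m n \<le> card (non_edges n (H n))"
    and "\<forall>\<^sub>F n in sequentially. real (m n) \<ge> 60 / \<delta>\<^sup>2 * ln (real n)"
  then show "whp (\<lambda>n. random_coloured_graph n (H n) (m n) 3) (\<lambda>n G. rainbow_connected n G)"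
    by (rule whp_rainbow_connected_three[OF assms(1)])
next
  assume "\<delta> \<le> 1 / 10"
  then have "\<forall>\<^sub>F n in sequentially. double_bip n \<in> dense_graphs n \<delta>"
    by (intro eventually_mono[OF eventually_ge_at_top[of 8]] double_bip_dense)
  then show "\<exists>H :: nat \<Rightarrow> nat set set.
      (\<forall>\<^sub>F n in sequentially. H n \<in> dense_graphs n \<delta>) \<and>
      (\<forall>m :: nat \<Rightarrow> nat. (\<forall>\<^sub>F n in sequentially. real (m n) \<le> 1/2 * ln (real n)) \<longrightarrow>
        (\<forall>\<^sub>F n in sequentially. m n \<le> card (non_edges n (H n))) \<and>
        whp (\<lambda>n. random_coloured_graph n (H n) (m n) 4) (\<lambda>n G. \<not> rainbow_connected n G))"
    by (intro exI[of _ double_bip] conjI[of "eventually _ _"] allI impI whp_double_bip_not_rainbow_connected)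
next
  fix H :: "nat \<Rightarrow> nat set set" and m :: "nat \<Rightarrow> nat"
  assume "\<forall>\<^sub>F n in sequentially. H n \<in> dense_graphs n \<delta> \<and> m n \<le> card (non_edges n (H n))"
    and "filterlim m at_top sequentially"
  then show "whp (\<lambda>n. random_coloured_graph n (H n) (m n) 7) (\<lambda>n G. rainbow_connected n G)"
    by (rule whp_rainbow_connected_seven[OF assms(1)])
qed

end
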